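(* Let $N$ be a positive integer, $\tau\in\mathbf C$ with $\operatorname{Im}\tau>0$, $\Lambda_\tau=\mathbf Z+\mathbf Z\tau$, $E_\tau=\mathbf C/\Lambda_\tau$, and $S=\frac\tau N$, $T=\frac1N$, $\tilde T=\frac1{2N}$ (mod $\Lambda_\tau$). Write $\theta_k(z)=\theta_k^{(N)}(z,\tau)$ and define $$X_k(z)=\frac{\theta_k(z)}{\theta_0(z)},\qquad k\in\mathbf Z/N\mathbf Z.$$ Then: (1) $X_k$ is a function on $E_\tau$ (a meromorphic function with periods $1,\tau$). (2) ${}^{T}\!X_k=\chi_S^k(T)X_k=\zeta_N^kX_k$. (3) ${}^{S}\!X_k=X_{k+1}\cdot(\theta_0/\theta_1)$. (4) $X_k(-z)=X_{-k}(z)$ for all $z\in E_\tau$. (5) If $N$ is odd, then $\operatorname{div}X_k={}^{kS}\!D_T-D_T$, where $D_T=\sum_{n=0}^{N-1}\{nT\}$, and $X_0,\dots,X_{N-1}$ form a basis of $\mathscr L^1(D_T)$. (6) If $N$ is even, then $\operatorname{div}X_k={}^{kS}\!D_{\tilde T}-D_{\tilde T}$, where $D_{\tilde T}=\sum_{n=0}^{N-1}\{\tilde T+nT\}$, and $X_0,\dots,X_{N-1}$ form a basis of $\mathscr L^1(D_{\tilde T})$.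
   Context: With $\mathbf e(x)=e^{2\pi i x}$ and $\zeta_N=\mathbf e(1/N)$, for an integer $k$, $$\theta^{(N)}_k(z,\tau)=\sum_{n\in\mathbf Z}\mathbf e\Bigl(\tfrac12N\bigl(n-\tfrac kN+\tfrac12\bigr)^2\tau+N\bigl(n-\tfrac kN+\tfrac12\bigr)\bigl(z+\tfrac12\bigr)\Bigr),$$ which depends only on $k\bmod N$. For a point $U\in E_\tau$: ${}^{U}\!f(z)=f(z-U)$ for a function $f$, and ${}^{U}\!\bigl(\sum n_P\{P\}\bigr)=\sum n_P\{P+U\}$ for a divisor, $\{P\}$ being the prime divisor of $P$. For a divisor $D$, $\mathscr L^1(D)$ is the vector space of functions $h$ on $E_\tau$ with $h=0$ or $\operatorname{div}h+D\ge0$. $\chi_S$ is the character $U\mapsto e_N(S,U)$ of $\langle T\rangle$, where the Weil pairing is normalized by $e_N(S,T)=f(z-T)/f(z)$ for $\operatorname{div}f=\sum_{n=0}^{N-1}(\{S+nT\}-\{nT\})$. *)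

theory Defs
  imports
    "HOL-Complex_Analysis.Complex_Analysis"
    "HOL-Algebra.Coset"
    "HOL-Algebra.Generated_Groups"
    "HOL-Library.Poly_Mapping"
begin

section \<open>Theta functions\<close>

definition ee :: "complex \<Rightarrow> complex" where
  "ee x = exp (2 * of_real pi * \<i> * x)"

definition zeta :: "nat \<Rightarrow> complex" where
  "zeta N = ee (1 / of_nat N)"

definition theta :: "nat \<Rightarrow> complex \<Rightarrow> int \<Rightarrow> complex \<Rightarrow> complex" where
  "theta N \<tau> k z =
     (\<Sum>\<^sub>\<infinity>n\<in>(UNIV::int set).
        ee (1/2 * of_nat N * (of_int n - of_int k / of_nat N + 1/2)^2 * \<tau>
            + of_nat N * (of_int n - of_int k / of_nat N + 1/2) * (z + 1/2)))"

lemma theta_add_multiple: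
  assumes "N > 0"
  shows "theta N \<tau> (k + int N * m) = theta N \<tau> k"
proof
  fix z
  have bij: "bij (\<lambda>n::int. n + m)"
    by (rule bij_betw_byWitness[where f' = "\<lambda>n. n - m"]) auto
  have eq: "complex_of_int (n + m) - of_int (k + int N * m) / of_nat N + 1/2
      = of_int n - of_int k / of_nat N + 1/2" for n
    using assms by (simp add: field_simps)
  show "theta N \<tau> (k + int N * m) z = theta N \<tau> k z"
    unfolding theta_def by (subst infsum_reindex_bij_betw[OF bij, symmetric]) (simp only: eq)
qed

section \<open>The ring of meromorphic functions on the plane\<close>

text \<open>Meromorphic functions that agree off a discrete closed set are identified; this makes
  their vector space structure, and quotients such as \<open>\<theta>\<^sub>k/\<theta>\<^sub>0\<close>, independent of the values
  that a raw function takes at poles and removable singularities.\<close>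

definition mero_rel :: "(complex \<Rightarrow> complex) \<Rightarrow> (complex \<Rightarrow> complex) \<Rightarrow> bool" where
  "mero_rel f g \<longleftrightarrow> f meromorphic_on UNIV \<and> g meromorphic_on UNIV \<and>
     eventually (\<lambda>z. f z = g z) (cosparse UNIV)"

lemma mero_rel_at:
  "mero_rel f g \<longleftrightarrow> f meromorphic_on UNIV \<and> g meromorphic_on UNIV \<and>
     (\<forall>z. eventually (\<lambda>w. f w = g w) (at z))"
  by (simp add: mero_rel_def eventually_cosparse_open_eq)

lemma mero_rel_refl: "f meromorphic_on UNIV \<Longrightarrow> mero_rel f f"
  by (simp add: mero_rel_def)

quotient_type mero = "complex \<Rightarrow> complex" / partial: mero_rel
proof (rule part_equivpI)
  show "\<exists>x. mero_rel x x" by (intro exI[of _ "\<lambda>_. 0"] mero_rel_refl meromorphic_on_const)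
  show "symp mero_rel" by (auto simp: symp_def mero_rel_def eq_commute)
  show "transp mero_rel"
    unfolding transp_def mero_rel_def
    by (auto elim: eventually_elim2)
qed

instantiation mero :: comm_ring_1
begin

lift_definition zero_mero :: mero is "\<lambda>_. 0" by (intro mero_rel_refl meromorphic_intros)
lift_definition one_mero :: mero is "\<lambda>_. 1" by (intro mero_rel_refl meromorphic_intros)
lift_definition plus_mero :: "mero \<Rightarrow> mero \<Rightarrow> mero" is "\<lambda>f g z. f z + g z"
  unfolding mero_rel_def by (auto intro: meromorphic_intros elim: eventually_elim2)
lift_definition minus_mero :: "mero \<Rightarrow> mero \<Rightarrow> mero" is "\<lambda>f g z. f z - g z"
  unfolding mero_rel_def by (auto intro: meromorphic_intros elim: eventually_elim2)
lift_definition times_mero :: "mero \<Rightarrow> mero \<Rightarrow> mero" is "\<lambda>f g z. f z * g z"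
  unfolding mero_rel_def by (auto intro: meromorphic_intros elim: eventually_elim2)
lift_definition uminus_mero :: "mero \<Rightarrow> mero" is "\<lambda>f z. - f z"
  unfolding mero_rel_def by (auto intro: meromorphic_intros elim: eventually_mono)

instance
proof
  show "(0::mero) \<noteq> 1"
    by transfer (auto simp: mero_rel_def)
qed (transfer; force simp: mero_rel_def algebra_simps intro: meromorphic_intros)+

end

lift_definition mero_scale :: "complex \<Rightarrow> mero \<Rightarrow> mero" is "\<lambda>c f z. c * f z"
  unfolding mero_rel_def by (auto intro: meromorphic_intros elim: eventually_mono)

global_interpretation mero: vector_space mero_scale
  by unfold_locales (transfer; force simp: mero_rel_def algebra_simps intro: meromorphic_intros)+

lemma mero_rel_affine:
  assumes "mero_rel f g" "a \<noteq> 0"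
  shows "mero_rel (\<lambda>z. f (a * z + b)) (\<lambda>z. g (a * z + b))"
proof -
  have "(\<lambda>z. h (a * z + b)) meromorphic_on UNIV" if "h meromorphic_on UNIV" for h
    by (rule meromorphic_on_compose[OF that]) (auto intro!: analytic_intros)
  moreover have "eventually (\<lambda>w. f (a * w + b) = g (a * w + b)) (at z)" for z
  proof -
    have "filterlim (\<lambda>w. a * w + b) (at (a * z + b)) (at z)"
      using assms(2) by (auto simp: filterlim_at eventually_at_filter intro!: tendsto_eq_intros)
    then show ?thesis
      using assms(1) eventually_compose_filterlim unfolding mero_rel_at by blast
  qed
  ultimately show ?thesis using assms(1) by (auto simp: mero_rel_at)
qed

lift_definition mero_shift :: "complex \<Rightarrow> mero \<Rightarrow> mero" is "\<lambda>u f z. f (z - u)"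
  using mero_rel_affine[of _ _ 1] by (simp add: diff_conv_add_uminus del: add_uminus_conv_diff)

lift_definition mero_reflect :: "mero \<Rightarrow> mero" is "\<lambda>f z. f (- z)"
  using mero_rel_affine[of _ _ "-1" 0] by simp

lift_definition mero_order :: "mero \<Rightarrow> complex \<Rightarrow> int" is zorder
  by (rule ext, rule zorder_cong) (auto simp: mero_rel_at)

section \<open>The elliptic curve, its functions and divisors\<close>

definition lattice :: "complex \<Rightarrow> complex set" where
  "lattice \<tau> = {of_int m + of_int n * \<tau> | m n. True}"

definition complex_group :: "complex monoid" where
  "complex_group = \<lparr>carrier = UNIV, monoid.mult = (+), one = 0\<rparr>"

text \<open>The group structure is written multiplicatively, as everywhere in HOL-Algebra: \<open>P + Q\<close>
  is \<open>P \<otimes>\<^bsub>Ell \<tau>\<^esub> Q\<close> and \<open>n P\<close> is \<open>P [^]\<^bsub>Ell \<tau>\<^esub> n\<close>.\<close>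

definition Ell :: "complex \<Rightarrow> complex set monoid" where
  "Ell \<tau> = complex_group Mod lattice \<tau>"

definition pt :: "complex \<Rightarrow> complex \<Rightarrow> complex set" where
  "pt \<tau> z = lattice \<tau> #>\<^bsub>complex_group\<^esub> z"

definition rep :: "complex set \<Rightarrow> complex" where
  "rep P = (SOME z. z \<in> P)"

definition Ell_functions :: "complex \<Rightarrow> mero set" where
  "Ell_functions \<tau> = {f. mero_shift 1 f = f \<and> mero_shift \<tau> f = f}"

text \<open>The translate does not depend on the chosen representative when \<open>f\<close> lies in
  \<open>Ell_functions \<tau>\<close> and \<open>U\<close> is a point of \<open>Ell \<tau>\<close>.\<close>

definition fun_translate :: "complex set \<Rightarrow> mero \<Rightarrow> mero" where
  "fun_translate U f = mero_shift (rep U) f"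

type_synonym divisor = "complex set \<Rightarrow>\<^sub>0 int"

definition div_translate :: "complex \<Rightarrow> complex set \<Rightarrow> divisor \<Rightarrow> divisor" where
  "div_translate \<tau> U D = frag_extend (\<lambda>P. frag_of (P \<otimes>\<^bsub>Ell \<tau>\<^esub> U)) D"

definition divisor_of :: "complex \<Rightarrow> mero \<Rightarrow> divisor" where
  "divisor_of \<tau> f =
     Abs_poly_mapping (\<lambda>P. if P \<in> carrier (Ell \<tau>) then mero_order f (rep P) else 0)"

lemma mem_pt: "x \<in> pt \<tau> z \<longleftrightarrow> (\<exists>m n. x = z + of_int m + of_int n * \<tau>)"
proof -
  have "x \<in> pt \<tau> z \<longleftrightarrow> (\<exists>m n. x = of_int m + of_int n * \<tau> + z)"
    unfolding pt_def r_coset_def complex_group_def lattice_def by auto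
  then show ?thesis by (simp only: add.assoc add.commute add.left_commute)
qed

lemma rep_in_pt: "\<exists>m n. rep (pt \<tau> z) = z + of_int m + of_int n * \<tau>"
proof -
  have "z \<in> pt \<tau> z"
    by (auto simp: mem_pt intro!: exI[of _ 0])
  then have "rep (pt \<tau> z) \<in> pt \<tau> z"
    unfolding rep_def by (rule someI)
  then show ?thesis
    by (simp add: mem_pt)
qed

lemma carrier_Ell: "carrier (Ell \<tau>) = range (pt \<tau>)"
  by (auto simp: Ell_def carrier_FactGroup pt_def complex_group_def)

lemma pt_add_period: "pt \<tau> (z + of_int m + of_int n * \<tau>) = pt \<tau> z"
proof -
  have sub: "pt \<tau> (w + of_int a + of_int b * \<tau>) \<subseteq> pt \<tau> w" for w a b
  proof
    fix x assume "x \<in> pt \<tau> (w + of_int a + of_int b * \<tau>)"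
    then obtain p q where "x = w + of_int a + of_int b * \<tau> + of_int p + of_int q * \<tau>"
      by (auto simp: mem_pt)
    then have "x = w + of_int (p + a) + of_int (q + b) * \<tau>"
      by (simp add: algebra_simps)
    then show "x \<in> pt \<tau> w"
      unfolding mem_pt by blast
  qed
  have eq: "(z + of_int m + of_int n * \<tau>) + of_int (-m) + of_int (-n) * \<tau> = z"
    by (simp add: algebra_simps)
  show ?thesis
    using sub[of z m n] sub[of "z + of_int m + of_int n * \<tau>" "-m" "-n"]
    unfolding eq by (rule subset_antisym)
qed

lemma mero_order_shift: "mero_order (mero_shift u f) z = mero_order f (z - u)"
proof transfer
  fix u z :: complex and f :: "complex \<Rightarrow> complex"
  show "zorder (\<lambda>z. f (z - u)) z = zorder f (z - u)"
    by (subst zorder_shift, subst (2) zorder_shift) (simp add: add_diff_eq)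
qed

lemma mero_order_period:
  assumes "f \<in> Ell_functions \<tau>"
  shows "mero_order f (z + of_int m + of_int n * \<tau>) = mero_order f z"
proof -
  have 1: "mero_order f (w - u) = mero_order f w" if "mero_shift u f = f" for w u
    using mero_order_shift[of u f w] that by simp
  have 2: "mero_order f (w + of_nat k * u) = mero_order f w" if "mero_shift u f = f" for w u k
  proof (induction k)
    case (Suc k)
    have "mero_order f (w + of_nat k * u) = mero_order f (w + of_nat (Suc k) * u)"
      using 1[OF that, of "w + of_nat (Suc k) * u"] by (simp add: algebra_simps)
    with Suc show ?case by simp
  qed auto
  have 3: "mero_order f (w + of_int k * u) = mero_order f w" if "mero_shift u f = f" for w u k
  proof (cases k)
    case (nonneg n)
    then show ?thesis using 2[OF that] by simp
  next
    case (neg n)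
    then have "w + of_int k * u + of_nat (Suc n) * u = w"
      by simp (simp add: algebra_simps)
    then show ?thesis
      using 2[OF that, of "w + of_int k * u" "Suc n"] by (simp only:)
  qed
  show ?thesis
    using 3[of 1 z m] 3[of \<tau> "z + of_int m" n] assms by (simp add: Ell_functions_def)
qed

lemma mero_order_rep:
  assumes "f \<in> Ell_functions \<tau>"
  shows "mero_order f (rep (pt \<tau> z)) = mero_order f z"
  using rep_in_pt[of \<tau> z] mero_order_period[OF assms] by auto

lemma sparse_mero_order:
  assumes "f \<noteq> 0"
  shows "{z. mero_order f z \<noteq> 0} sparse_in UNIV"
  using assms
proof transfer
  fix f :: "complex \<Rightarrow> complex"
  assume f: "mero_rel f f" and nz: "\<not> mero_rel f (\<lambda>_. 0)"
  have mer: "f meromorphic_on UNIV" using f by (simp add: mero_rel_def)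
  have "eventually (\<lambda>z. f z \<noteq> 0) (cosparse UNIV)"
    using meromorphic_imp_constant_or_avoid[OF mer, of 0] nz mer
    by (auto simp: mero_rel_def)
  with meromorphic_on_imp_analytic_cosparse[OF mer]
  have "eventually (\<lambda>z. zorder f z = 0) (cosparse UNIV)"
    by eventually_elim (rule zorder_eq_0I)
  then show "{z. zorder f z \<noteq> 0} sparse_in UNIV"
    by (simp add: eventually_cosparse)
qed

lemma lookup_divisor_of:
  assumes "Im \<tau> > 0" "f \<in> Ell_functions \<tau>" "f \<noteq> 0"
  shows "Poly_Mapping.lookup (divisor_of \<tau> f) (pt \<tau> z) = mero_order f z"
proof -
  define K where "K = (\<lambda>(x, y). of_real x + of_real y * \<tau>) ` ({0..1} \<times> {0..1} :: (real \<times> real) set)"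
  have "compact K"
    unfolding K_def by (intro compact_continuous_image compact_Times continuous_intros compact_Icc)
      (auto simp: case_prod_unfold intro!: continuous_intros)
  then have fin: "finite (K \<inter> {z. mero_order f z \<noteq> 0})"
    using sparse_mero_order[OF assms(3)] sparse_in_compact_finite sparse_in_subset by blast
  have "{P. (if P \<in> carrier (Ell \<tau>) then mero_order f (rep P) else 0) \<noteq> 0}
          \<subseteq> pt \<tau> ` (K \<inter> {z. mero_order f z \<noteq> 0})"
  proof
    fix P assume "P \<in> {P. (if P \<in> carrier (Ell \<tau>) then mero_order f (rep P) else 0) \<noteq> 0}"
    then obtain w where P: "P = pt \<tau> w" and ord: "mero_order f w \<noteq> 0"
      by (auto simp: carrier_Ell mero_order_rep[OF assms(2)] split: if_splits)
    define y where "y = Im w / Im \<tau>"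
    define x where "x = Re w - y * Re \<tau>"
    have w: "w = of_real x + of_real y * \<tau>"
      using assms(1) by (simp add: complex_eq_iff x_def y_def)
    define w' where "w' = w + of_int (- \<lfloor>x\<rfloor>) + of_int (- \<lfloor>y\<rfloor>) * \<tau>"
    have "w' = of_real (frac x) + of_real (frac y) * \<tau>"
      by (simp add: w'_def w frac_def algebra_simps)
    then have "w' \<in> K"
      unfolding K_def using frac_lt_1[of x] frac_lt_1[of y]
      by (intro image_eqI[of _ _ "(frac x, frac y)"]) auto
    moreover have "mero_order f w' \<noteq> 0"
      unfolding w'_def mero_order_period[OF assms(2)] by (rule ord)
    moreover have "P = pt \<tau> w'"
      unfolding w'_def P pt_add_period ..
    ultimately show "P \<in> pt \<tau> ` (K \<inter> {z. mero_order f z \<noteq> 0})" by blast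
  qed
  then have "finite {P. (if P \<in> carrier (Ell \<tau>) then mero_order f (rep P) else 0) \<noteq> 0}"
    using fin finite_subset by blast
  then show ?thesis
    by (simp add: divisor_of_def Abs_poly_mapping_inverse carrier_Ell mero_order_rep[OF assms(2)])
qed

text \<open>Effectivity is pointwise; the order on \<open>\<Rightarrow>\<^sub>0\<close> in the library is lexicographic.\<close>

definition effective :: "divisor \<Rightarrow> bool" where
  "effective D \<longleftrightarrow> (\<forall>P. Poly_Mapping.lookup D P \<ge> 0)"

definition L1 :: "complex \<Rightarrow> divisor \<Rightarrow> mero set" where
  "L1 \<tau> D = {h \<in> Ell_functions \<tau>. h = 0 \<or> effective (divisor_of \<tau> h + D)}"

definition is_basis :: "('i \<Rightarrow> mero) \<Rightarrow> 'i set \<Rightarrow> mero set \<Rightarrow> bool" where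
  "is_basis v I V \<longleftrightarrow> inj_on v I \<and> mero.independent (v ` I) \<and> mero.span (v ` I) = V"

section \<open>The Weil pairing and the functions \<open>X\<^sub>k\<close>\<close>

text \<open>For \<open>N\<close>-torsion points \<open>P\<close>, \<open>Q\<close> the value is \<open>f(z - Q)/f(z)\<close> for any \<open>f\<close> with divisor
  \<open>\<Sum>\<^sub>n ({P + nQ} - {nQ})\<close>; such an \<open>f\<close> is unique up to a constant factor.\<close>

definition weil :: "complex \<Rightarrow> nat \<Rightarrow> complex set \<Rightarrow> complex set \<Rightarrow> complex" where
  "weil \<tau> N P Q = (THE c. \<exists>f \<in> Ell_functions \<tau>. f \<noteq> 0 \<and>
     divisor_of \<tau> f =
       (\<Sum>n<N. frag_of (P \<otimes>\<^bsub>Ell \<tau>\<^esub> Q [^]\<^bsub>Ell \<tau>\<^esub> n) - frag_of (Q [^]\<^bsub>Ell \<tau>\<^esub> n)) \<and>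
     fun_translate Q f = mero_scale c f)"

definition weil_char :: "complex \<Rightarrow> nat \<Rightarrow> complex set \<Rightarrow> complex set \<Rightarrow> complex set \<Rightarrow> complex" where
  "weil_char \<tau> N T P = (\<lambda>U\<in>generate (Ell \<tau>) {T}. weil \<tau> N P U)"

definition theta_quotient :: "nat \<Rightarrow> complex \<Rightarrow> int \<Rightarrow> int \<Rightarrow> complex \<Rightarrow> complex" where
  "theta_quotient N \<tau> k l = (\<lambda>z. theta N \<tau> k z / theta N \<tau> l z)"

text \<open>\<open>abs_mero f\<close> is the class of \<open>f\<close> if \<open>f\<close> is meromorphic, and unspecified otherwise.\<close>

definition Xfun :: "nat \<Rightarrow> complex \<Rightarrow> int \<Rightarrow> mero" where
  "Xfun N \<tau> k = abs_mero (theta_quotient N \<tau> k 0)"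

end

(* A theta function theta_k is, up to an exponential factor, a constant multiple of the
   product P(w) = (x; q) (q/x; q) at w = N z - k tau + const, where x = e(w) and q = e(N tau): P
   visibly has simple zeros exactly at the lattice Z + Z N tau, and any entire function G with the
   periodicity of P is a multiple of P. For the latter choose c such that H = G - c P vanishes at
   1/2; then H(w) / P(w - 1/2) is entire, invariant under w -> w + 1 and changes sign under
   w -> w + N tau, so it is bounded, hence constant, hence 0. This gives the divisors.

   For the bases, h lies in L^1 if and only if g = h theta_0 is entire; then g has the periods of
   theta_0. Splitting g into eigenfunctions of z -> z - 1/N, each eigenfunction has the
   periodicity of some theta_k, and is therefore a multiple of it. *)
theory Submission
  imports Defs
begin

section \<open>The theta product\<close>

text \<open>That G vanishes where P does is not visible from its periodicity; it would usually come
  from counting zeros by a contour integral. Subtracting c P plants a zero at a point of one's own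
  choice instead, and the multipliers spread it over the coset 1/2 + Z + Z t. The shift by 1/2 does
  double duty: it keeps this coset away from the zeros of P, where c could not be solved for, and it
  turns the multiplier -e(-w) of P into e(-w), so that the quotient gets the multiplier -1, which no
  nonzero constant has. Uniqueness gives the triple product identity up to a constant, and one
  Fourier coefficient shows that the constant is nonzero. The splitting into eigenfunctions yields
  spanning and independence at once, in the role of a dimension count. The parity of N enters only
  at the end: all divisors are computed from the single point (1 - N)/(2N), which is a multiple of
  1/N for odd N and differs from 1/(2N) by such a multiple for even N.\<close>

lemma ee_add: "ee (x + y) = ee x * ee y"
  by (simp add: ee_def algebra_simps exp_add)

lemma ee_diff: "ee (x - y) = ee x / ee y"
  by (simp add: ee_def algebra_simps exp_diff)

lemma ee_minus: "ee (- x) = inverse (ee x)"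
  by (simp add: ee_def exp_minus)

lemma ee_nonzero [simp]: "ee x \<noteq> 0"
  by (simp add: ee_def)

lemma ee_zero [simp]: "ee 0 = 1"
  by (simp add: ee_def)

lemma ee_eq_1_iff: "ee x = 1 \<longleftrightarrow> x \<in> \<int>"
proof -
  have "ee x = 1 \<longleftrightarrow> (\<exists>n::int. x = of_int n)"
    unfolding ee_def exp_eq_1
    by (auto simp: complex_eq_iff field_simps)
  then show ?thesis by (auto simp: Ints_def)
qed

lemma ee_of_int [simp]: "ee (of_int n) = 1"
  by (simp add: ee_eq_1_iff)

lemma ee_of_nat [simp]: "ee (of_nat n) = 1"
  by (simp add: ee_eq_1_iff)

lemma ee_1 [simp]: "ee 1 = 1"
  by (simp add: ee_eq_1_iff)

lemma ee_half [simp]: "ee (1/2) = -1"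
  by (simp add: ee_def)

lemma norm_ee: "norm (ee x) = exp (- 2 * pi * Im x)"
  by (simp add: ee_def)

lemma ee_powi: "ee x powi k = ee (of_int k * x)"
  by (simp add: ee_def exp_power_int algebra_simps)

lemma ee_power: "ee x ^ k = ee (of_nat k * x)"
  by (simp add: ee_def exp_of_nat_mult [symmetric] algebra_simps)

lemma ee_holomorphic [holomorphic_intros]:
  "f holomorphic_on A \<Longrightarrow> (\<lambda>z. ee (f z)) holomorphic_on A"
  unfolding ee_def by (intro holomorphic_intros)

lemma continuous_on_ee [continuous_intros]:
  "continuous_on A f \<Longrightarrow> continuous_on A (\<lambda>z. ee (f z))"
  unfolding ee_def by (intro continuous_intros)

text \<open>The infinite q-Pochhammer symbol (x; q). The limit exists for |q| < 1, by
  \<open>qpoch_LIMSEQ\<close>.\<close>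

definition qpoch :: "complex \<Rightarrow> complex \<Rightarrow> complex" where
  "qpoch q x = lim (\<lambda>m. \<Prod>n<m. 1 - q ^ n * x)"

context
  fixes q :: complex
  assumes q: "norm q < 1"
begin

lemma qpoch_uniform_limit:
  "uniform_limit (cball 0 r) (\<lambda>m x. \<Prod>n<m. 1 - q ^ n * x) (qpoch q) sequentially"
proof -
  have "uniformly_convergent_on (cball 0 r) (\<lambda>m x. \<Prod>n<m. 1 - q ^ n * x)"
  proof (rule uniformly_convergent_on_prod')
    show "uniformly_convergent_on (cball 0 r) (\<lambda>N x. \<Sum>n<N. norm (1 - q ^ n * x - 1))"
    proof (rule Weierstrass_m_test'[where M = "\<lambda>n. norm q ^ n * \<bar>r\<bar>"])
      show "summable (\<lambda>n. norm q ^ n * \<bar>r\<bar>)"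
        using q by (intro summable_mult2 summable_geometric) auto
    qed (auto simp: norm_mult norm_power intro!: mult_left_mono)
  qed (auto intro!: continuous_intros)
  then show ?thesis
    unfolding uniformly_convergent_uniform_limit_iff qpoch_def[abs_def] .
qed

lemma qpoch_LIMSEQ: "(\<lambda>m. \<Prod>n<m. 1 - q ^ n * x) \<longlonglongrightarrow> qpoch q x"
  by (rule tendsto_uniform_limitI[OF qpoch_uniform_limit[of "norm x"]]) auto

lemma holomorphic_qpoch: "qpoch q holomorphic_on UNIV"
proof (rule holomorphic_uniform_sequence)
  show "\<exists>d>0. cball x d \<subseteq> UNIV \<and> uniform_limit (cball x d) (\<lambda>m x. \<Prod>n<m. 1 - q ^ n *
      x) (qpoch q) sequentially" for x
    by (intro exI[of _ 1] conjI uniform_limit_on_subset[OF qpoch_uniform_limit[of "norm x + 1"]])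
       (auto simp: cball_subset_cball_iff)
qed (auto intro!: holomorphic_intros)

lemma qpoch_0 [simp]: "qpoch q 0 = 1"
  by (simp add: qpoch_def)

lemma qpoch_rec: "qpoch q x = (1 - x) * qpoch q (q * x)"
proof -
  have "(\<Prod>n<Suc m. 1 - q ^ n * x) = (1 - x) * (\<Prod>n<m. 1 - q ^ n * (q * x))" for m
    by (subst prod.lessThan_Suc_shift) (simp add: algebra_simps)
  moreover have "(\<lambda>m. (1 - x) * (\<Prod>n<m. 1 - q ^ n * (q * x))) \<longlonglongrightarrow> (1 - x) * qpoch q (q * x)"
    by (intro tendsto_intros qpoch_LIMSEQ)
  ultimately have "(\<lambda>m. \<Prod>n<Suc m. 1 - q ^ n * x) \<longlonglongrightarrow> (1 - x) * qpoch q (q * x)"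
    by simp
  moreover have "(\<lambda>m. \<Prod>n<Suc m. 1 - q ^ n * x) \<longlonglongrightarrow> qpoch q x"
    using qpoch_LIMSEQ by (rule LIMSEQ_Suc)
  ultimately show ?thesis
    using LIMSEQ_unique by blast
qed

text \<open>If no factor vanishes, \<open>qpoch_rec\<close> passes the zero on from x to q x, q^2 x
  and so on. These points tend to 0, where the product is 1, against continuity.\<close>

lemma qpoch_eq_0D:
  assumes "qpoch q x = 0"
  shows "\<exists>n. q ^ n * x = 1"
proof (rule ccontr)
  assume *: "\<nexists>n. q ^ n * x = 1"
  have "qpoch q (q ^ n * x) = 0" for n
  proof (induction n)
    case (Suc n)
    then show ?case
      using qpoch_rec[of "q ^ n * x"] * by (auto simp: mult.assoc)
  qed (use assms in auto)
  moreover have "(\<lambda>n. qpoch q (q ^ n * x)) \<longlonglongrightarrow> qpoch q (0 * x)"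
  proof (rule continuous_on_tendsto_compose[where s = UNIV and f = "qpoch q"])
    show "continuous_on UNIV (qpoch q)"
      using holomorphic_on_imp_continuous_on holomorphic_qpoch by blast
    show "(\<lambda>n. q ^ n * x) \<longlonglongrightarrow> 0 * x"
      using q by (intro tendsto_mult LIMSEQ_power_zero tendsto_const) auto
  qed auto
  ultimately show False
    by (simp add: LIMSEQ_const_iff)
qed

end

lemma holomorphic_qpoch_comp [holomorphic_intros]:
  assumes "norm q < 1" "f holomorphic_on A"
  shows "(\<lambda>z. qpoch q (f z)) holomorphic_on A"
  using holomorphic_on_compose_gen[OF assms(2) holomorphic_qpoch[OF assms(1)]]
  by (simp add: o_def)

definition theta_prod :: "complex \<Rightarrow> complex \<Rightarrow> complex" where
  "theta_prod t z = qpoch (ee t) (ee z) * qpoch (ee t) (ee (t - z))"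

lemma theta_prod_add_1: "theta_prod t (z + 1) = theta_prod t z"
  by (simp add: theta_prod_def ee_add ee_diff)

context
  fixes t :: complex
  assumes t: "Im t > 0"
begin

lemma norm_ee_less_1: "norm (ee t) < 1"
  using t by (simp add: norm_ee)

lemma holomorphic_theta_prod: "theta_prod t holomorphic_on UNIV"
  unfolding theta_prod_def [abs_def] by (intro holomorphic_intros norm_ee_less_1)

text \<open>Passing from z to z + t, the first product loses its factor 1 - e(z) and the second
  gains 1 - e(-z); the ratio of the two is -e(-z).\<close>

lemma theta_prod_add_period: "theta_prod t (z + t) = - ee (- z) * theta_prod t z"
proof -
  have "qpoch (ee t) (ee (- z)) = (1 - ee (- z)) * qpoch (ee t) (ee (t - z))"
    using qpoch_rec[OF norm_ee_less_1, of "ee (- z)"] by (simp add: ee_add [symmetric])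
  moreover have "qpoch (ee t) (ee z) = (1 - ee z) * qpoch (ee t) (ee (z + t))"
    using qpoch_rec[OF norm_ee_less_1, of "ee z"] by (simp add: ee_add mult.commute)
  moreover have "1 - ee (- z) = - ee (- z) * (1 - ee z)"
    by (simp add: ee_minus field_simps)
  ultimately show ?thesis
    by (simp add: theta_prod_def)
qed

lemma theta_prod_0: "theta_prod t 0 = 0"
  using qpoch_rec[OF norm_ee_less_1, of 1] by (simp add: theta_prod_def)

lemma theta_prod_eq_0D:
  assumes "theta_prod t z = 0"
  shows "\<exists>m n::int. z = of_int m + of_int n * t"
proof -
  consider "qpoch (ee t) (ee z) = 0" | "qpoch (ee t) (ee (t - z)) = 0"
    using assms by (auto simp: theta_prod_def)
  then show ?thesis
  proof cases
    case 1
    from qpoch_eq_0D[OF norm_ee_less_1 this] obtain n where "ee (of_nat n * t + z) = 1"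
      by (auto simp: ee_add ee_power)
    then obtain m :: int where "of_nat n * t + z = of_int m"
      by (auto simp: ee_eq_1_iff elim: Ints_cases)
    then have "z = of_int m + of_int (- int n) * t" by (simp add: algebra_simps)
    then show ?thesis by blast
  next
    case 2
    from qpoch_eq_0D[OF norm_ee_less_1 this] obtain n where "ee (of_nat n * t + (t - z)) = 1"
      by (auto simp: ee_add ee_power)
    then obtain m :: int where "of_nat n * t + (t - z) = of_int m"
      by (auto simp: ee_eq_1_iff elim: Ints_cases)
    then have "z = of_int (-m) + of_int (int n + 1) * t" by (simp add: algebra_simps)
    then show ?thesis by blast
  qed
qed

text \<open>Carries what is known at 0, the zero and its simplicity, to every lattice point. For
  this it is enough that the factor is holomorphic and has no zeros, so its formula is left
  out.\<close>

lemma theta_prod_lattice_factor: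
  "\<exists>h. (\<forall>z. h z \<noteq> 0) \<and> (\<forall>z. theta_prod t (z + of_int m + of_int n * t) = h z * theta_prod t z)
     \<and> h holomorphic_on UNIV"
proof -
  have 1: "theta_prod t (z + of_int m) = theta_prod t z" for z m
  proof (induction m rule: int_induct[where k = 0])
    case (step1 i)
    then show ?case using theta_prod_add_1[of t "z + of_int i"] by (simp add: add.assoc)
  next
    case (step2 i)
    then show ?case using theta_prod_add_1[of t "z + of_int (i - 1)"] by (simp add: add.assoc)
  qed auto
  have "\<exists>h. (\<forall>z. h z \<noteq> 0) \<and> (\<forall>z. theta_prod t (z + of_int n * t) = h z * theta_prod t z)
     \<and> h holomorphic_on UNIV"
  proof (induction n rule: int_induct[where k = 0])
    case base
    then show ?case by (intro exI[of _ "\<lambda>_. 1"]) auto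
  next
    case (step1 i)
    then obtain h where h: "\<And>z. h z \<noteq> 0" "\<And>z. theta_prod t (z + of_int i * t) = h z * theta_prod t z"
      "h holomorphic_on UNIV" by blast
    have "theta_prod t (z + of_int (i + 1) * t) = (- ee (- (z + of_int i * t)) * h z) *
        theta_prod t z" for z
      using theta_prod_add_period[of "z + of_int i * t"] h(2)[of z] by (simp add: algebra_simps)
    with h show ?case
      by (intro exI[of _ "\<lambda>z. - ee (- (z + of_int i * t)) * h z"]) (auto intro!: holomorphic_intros)
  next
    case (step2 i)
    then obtain h where h: "\<And>z. h z \<noteq> 0" "\<And>z. theta_prod t (z + of_int i * t) = h z * theta_prod t z"
      "h holomorphic_on UNIV" by blast
    have "theta_prod t (z + of_int (i - 1) * t) = (- ee (z + of_int (i - 1) * t) * h z) *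
        theta_prod t z" for z
    proof -
      define w where "w = z + of_int (i - 1) * t"
      have "w + t = z + of_int i * t"
        by (simp add: w_def algebra_simps)
      then have "- ee (- w) * theta_prod t w = h z * theta_prod t z"
        using theta_prod_add_period[of w] h(2)[of z] by simp
      \<comment> \<open>The period formula leads from w to w + t; the downward step inverts it by
        multiplying with e(w).\<close>
      then have "ee w * (- ee (- w)) * theta_prod t w = ee w * (h z * theta_prod t z)"
        by (simp only: mult.assoc)
      then show ?thesis
        unfolding w_def [symmetric] by (simp add: ee_minus mult.assoc) (metis minus_minus)
    qed
    with h show ?case
      by (intro exI[of _ "\<lambda>z. - ee (z + of_int (i - 1) * t) * h z"]) (auto intro!: holomorphic_intros)
  qed
  then obtain h where "\<And>z. h z \<noteq> 0" "\<And>z. theta_prod t (z + of_int n * t) = h z * theta_prod t z"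
      "h holomorphic_on UNIV" by blast
  moreover have "theta_prod t (z + of_int m + of_int n * t) = theta_prod t (z + of_int n * t)" for z
    using 1[of "z + of_int n * t" m] by (simp add: algebra_simps)
  ultimately show ?thesis by (intro exI[of _ h]) auto
qed

lemma theta_prod_eq_0_iff: "theta_prod t z = 0 \<longleftrightarrow> (\<exists>m n::int. z = of_int m + of_int n * t)"
proof
  assume "\<exists>m n::int. z = of_int m + of_int n * t"
  then obtain m n :: int where z: "z = 0 + of_int m + of_int n * t" by auto
  have "\<exists>c. theta_prod t (0 + of_int m + of_int n * t) = c * theta_prod t 0"
    using theta_prod_lattice_factor[of m n] by blast
  then show "theta_prod t z = 0"
    unfolding z theta_prod_0 by simp
qed (rule theta_prod_eq_0D)

lemma deriv_theta_prod_0: "deriv (theta_prod t) 0 \<noteq> 0"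
proof -
  \<comment> \<open>What remains of the product after splitting off 1 - e(z), the only factor that
    vanishes at 0.\<close>
  define g where "g z = qpoch (ee t) (ee (t + z)) * qpoch (ee t) (ee (t - z))" for z
  have eq: "theta_prod t = (\<lambda>z. (1 - ee z) * g z)"
  proof
    fix z
    show "theta_prod t z = (1 - ee z) * g z"
      using qpoch_rec[OF norm_ee_less_1, of "ee z"] by (simp add: theta_prod_def g_def ee_add)
  qed
  have "g holomorphic_on UNIV"
    unfolding g_def by (intro holomorphic_intros norm_ee_less_1)
  then have g: "(g has_field_derivative deriv g 0) (at 0)"
    using holomorphic_derivI[of g UNIV 0] by auto
  have "((\<lambda>z. (1 - ee z) * g z) has_field_derivative (- (2 * of_real pi * \<i>) * g 0)) (at 0)"
    unfolding ee_def by (auto intro!: derivative_eq_intros g)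
  then have "deriv (theta_prod t) 0 = - (2 * of_real pi * \<i>) * g 0"
    unfolding eq by (rule DERIV_imp_deriv)
  \<comment> \<open>g(0) is the square of this number, and a zero would make a positive power of
    e(t) equal to 1 although |e(t)| < 1.\<close>
  moreover have "qpoch (ee t) (ee t) \<noteq> 0"
  proof
    assume "qpoch (ee t) (ee t) = 0"
    from qpoch_eq_0D[OF norm_ee_less_1 this] obtain n where "ee t ^ Suc n = 1"
      by (auto simp: mult.commute)
    then have "norm (ee t) ^ Suc n = 1"
      by (metis norm_one norm_power)
    then show False
      using norm_ee_less_1 power_Suc_less_one[of "norm (ee t)" n] by auto
  qed
  ultimately show ?thesis by (simp add: g_def)
qed

text \<open>Differentiating P(w + z) = h(w) P(w) at w = 0 leaves only h(0) P'(0), because P(0) = 0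
  removes the term with h'.\<close>

lemma deriv_theta_prod:
  assumes "theta_prod t z = 0"
  shows "deriv (theta_prod t) z \<noteq> 0"
proof -
  obtain m n :: int where z: "z = of_int m + of_int n * t"
    using theta_prod_eq_0D[OF assms] by blast
  obtain h where h: "\<And>z. h z \<noteq> 0" "\<And>w. theta_prod t (w + of_int m + of_int n * t) =
      h w * theta_prod t w"
      "h holomorphic_on UNIV" using theta_prod_lattice_factor by blast
  have P: "(theta_prod t has_field_derivative deriv (theta_prod t) w) (at w)" for w
    using holomorphic_derivI[OF holomorphic_theta_prod] by auto
  have "(h has_field_derivative deriv h 0) (at 0)"
    using holomorphic_derivI[OF h(3)] by auto
  then have "((\<lambda>w. h w * theta_prod t w) has_field_derivative h 0 * deriv (theta_prod t) 0) (at 0)"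
    by (auto intro!: derivative_eq_intros P simp: theta_prod_0)
  moreover have "((\<lambda>w. theta_prod t (w + z)) has_field_derivative deriv (theta_prod t) z) (at 0)"
    using P[of z] DERIV_shift[of "theta_prod t" _ 0 z] by simp
  moreover have "(\<lambda>w. theta_prod t (w + z)) = (\<lambda>w. h w * theta_prod t w)"
    using h(2) by (simp add: z add.assoc)
  ultimately have "deriv (theta_prod t) z = h 0 * deriv (theta_prod t) 0"
    by (simp add: DERIV_unique)
  then show ?thesis using h(1) deriv_theta_prod_0 by simp
qed

end

section \<open>Entire functions with the periodicity of the theta product\<close>

text \<open>At a zero a of R the quotient is given its l'Hopital value. Near a it is the quotient of
  the difference quotients of H and R at a; both extend holomorphically, and the second does not
  vanish at a because the zero is simple.\<close>

lemma entire_divide_simple_zeros: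
  fixes H R :: "complex \<Rightarrow> complex"
  assumes H: "H holomorphic_on UNIV" and R: "R holomorphic_on UNIV"
    and simple: "\<And>z. R z = 0 \<Longrightarrow> deriv R z \<noteq> 0"
    and vanish: "\<And>z. R z = 0 \<Longrightarrow> H z = 0"
  obtains E where "E holomorphic_on UNIV" "\<And>z. H z = E z * R z"
proof -
  define E where "E z = (if R z = 0 then deriv H z / deriv R z else H z / R z)" for z
  have "E analytic_on {a}" for a
  proof (cases "R a = 0")
    case True
    define h where "h z = (if z = a then deriv H a else (H z - H a) / (z - a))" for z
    define r where "r z = (if z = a then deriv R a else (R z - R a) / (z - a))" for z
    have hr: "h holomorphic_on UNIV" "r holomorphic_on UNIV"
      unfolding h_def r_def using H R by (intro pole_lemma_open; simp)+
    have "isCont r a"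
      using hr(2) holomorphic_on_imp_continuous_on continuous_on_eq_continuous_at by blast
    then have "eventually (\<lambda>z. r z \<noteq> 0) (at a)"
      using simple[OF True] unfolding isCont_def
      by (intro tendsto_imp_eventually_ne[of r "r a"]) (auto simp: r_def)
    then have "eventually (\<lambda>z. r z \<noteq> 0) (nhds a)"
      using simple[OF True] by (simp add: eventually_nhds_conv_at r_def)
    then have "eventually (\<lambda>z. E z = h z / r z) (nhds a)"
      by eventually_elim (auto simp: E_def h_def r_def True vanish split: if_splits)
    moreover have "(\<lambda>z. h z / r z) analytic_on {a}"
      using hr simple[OF True]
      by (intro analytic_on_divide) (auto simp: r_def [of a] analytic_on_holomorphic)
    ultimately show ?thesis by (subst analytic_at_cong) auto
  next
    case False
    have "isCont R a"
      using R holomorphic_on_imp_continuous_on continuous_on_eq_continuous_at by blast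
    then have "eventually (\<lambda>z. R z \<noteq> 0) (at a)"
      using False unfolding isCont_def by (rule tendsto_imp_eventually_ne)
    then have "eventually (\<lambda>z. R z \<noteq> 0) (nhds a)"
      using False by (simp add: eventually_nhds_conv_at)
    then have "eventually (\<lambda>z. E z = H z / R z) (nhds a)"
      by eventually_elim (auto simp: E_def)
    moreover have "(\<lambda>z. H z / R z) analytic_on {a}"
      using H R False
      by (intro analytic_on_divide) (auto simp: analytic_on_holomorphic)
    ultimately show ?thesis by (subst analytic_at_cong) auto
  qed
  then have "E holomorphic_on UNIV"
    using analytic_on_analytic_at analytic_imp_holomorphic by blast
  moreover have "H z = E z * R z" for z
    by (simp add: E_def vanish)
  ultimately show ?thesis by (rule that)
qed

lemma entire_eventually_nonzero:
  assumes "R holomorphic_on UNIV" "R b \<noteq> 0"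
  shows "eventually (\<lambda>z. R z \<noteq> 0) (at a)"
  using non_zero_neighbour_alt[of R UNIV a b] assms by (auto elim: eventually_mono)

lemma continuous_eqI_at:
  fixes f g :: "complex \<Rightarrow> complex"
  assumes "continuous_on UNIV f" "continuous_on UNIV g" "eventually (\<lambda>z. f z = g z) (at a)"
  shows "f a = g a"
proof -
  have "f \<midarrow>a\<rightarrow> f a" "g \<midarrow>a\<rightarrow> g a"
    using assms(1,2) by (auto simp: continuous_on_eq_continuous_at isCont_def)
  moreover from this(2) have "f \<midarrow>a\<rightarrow> g a"
    using tendsto_cong[OF assms(3)] by blast
  ultimately show ?thesis
    using tendsto_unique[OF at_neq_bot] by blast
qed

text \<open>The zeros of R are isolated, so f and g agree near a except possibly at a, and
  continuity fills in the point.\<close>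

lemma continuous_mult_entire_cancel:
  fixes f g R :: "complex \<Rightarrow> complex"
  assumes "continuous_on UNIV f" "continuous_on UNIV g" "R holomorphic_on UNIV" "R b \<noteq> 0"
    and eq: "\<And>z. f z * R z = g z * R z"
  shows "f a = g a"
proof (rule continuous_eqI_at[OF assms(1,2)])
  show "eventually (\<lambda>z. f z = g z) (at a)"
    using entire_eventually_nonzero[OF assms(3,4), of a] by eventually_elim (use eq in auto)
qed

text \<open>The value type of f is left open: the lemma is applied to norms, to the predicate that a
  function vanishes at z, and to translation of a meromorphic function by z.\<close>

lemma invariant_under_lattice:
  assumes 1: "\<And>z. f (z + 1) = f z" and t: "\<And>z. f (z + t) = f z"
  shows "f (z + of_int m + of_int n * t) = f (z :: complex)"
proof -
  have *: "f (w + of_int k * u) = f w" if "\<And>z. f (z + u) = f z" for w u k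
  proof (induction k rule: int_induct[where k = 0])
    case (step1 i)
    then show ?case using that[of "w + of_int i * u"] by (simp add: algebra_simps)
  next
    case (step2 i)
    then show ?case using that[of "w + of_int (i - 1) * u"] by (simp add: algebra_simps)
  qed auto
  show ?thesis
    using *[of 1 z m] *[of t "z + of_int m" n] 1 t by simp
qed

text \<open>Liouville on a compact period parallelogram. Asking only for a periodic norm admits
  multipliers of absolute value 1, such as the sign that appears in
  \<open>theta_prod_unique\<close>.\<close>

lemma entire_norm_doubly_periodic_imp_const:
  assumes "Im t > 0" and f: "f holomorphic_on UNIV"
    and 1: "\<And>z. norm (f (z + 1)) = norm (f z)" and t: "\<And>z. norm (f (z + t)) = norm (f z)"
  shows "\<exists>c. \<forall>z. f z = c"
proof -
  define K where "K = (\<lambda>(x, y). of_real x + of_real y * t) ` ({0..1} \<times> {0..1} :: (real \<times> real) set)"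
  have "compact K"
    unfolding K_def by (intro compact_continuous_image compact_Times continuous_intros compact_Icc)
      (auto simp: case_prod_unfold intro!: continuous_intros)
  moreover have "continuous_on K f"
    using f holomorphic_on_imp_continuous_on continuous_on_subset by blast
  ultimately have "bounded (f ` K)"
    by (intro compact_imp_bounded compact_continuous_image)
  then obtain B where B: "\<And>z. z \<in> K \<Longrightarrow> norm (f z) \<le> B"
    by (auto simp: bounded_iff)
  have "norm (f w) \<le> B" for w
  proof -
    define y where "y = Im w / Im t"
    define x where "x = Re w - y * Re t"
    have w: "w = of_real x + of_real y * t"
      using assms(1) by (simp add: complex_eq_iff x_def y_def)
    define w' where "w' = w + of_int (- \<lfloor>x\<rfloor>) + of_int (- \<lfloor>y\<rfloor>) * t"
    have "w' = of_real (frac x) + of_real (frac y) * t"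
      by (simp add: w'_def w frac_def algebra_simps)
    then have "w' \<in> K"
      unfolding K_def using frac_lt_1[of x] frac_lt_1[of y]
      by (intro image_eqI[of _ _ "(frac x, frac y)"]) auto
    then have "norm (f w') \<le> B" by (rule B)
    then show ?thesis
      unfolding w'_def invariant_under_lattice[where f = "\<lambda>z. norm (f z)", OF 1 t] .
  qed
  then have "bounded (range f)"
    by (auto simp: bounded_iff)
  with f have "f constant_on UNIV"
    by (rule Liouville_theorem)
  then show ?thesis by (auto simp: constant_on_def)
qed

lemma theta_prod_unique:
  assumes t: "Im t > 0" and G: "G holomorphic_on UNIV"
    and G1: "\<And>z. G (z + 1) = G z" and Gt: "\<And>z. G (z + t) = - ee (- z) * G z"
  shows "\<exists>c. \<forall>z. G z = c * theta_prod t z"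
proof -
  define c where "c = G (1/2) / theta_prod t (1/2)"
  define H where "H z = G z - c * theta_prod t z" for z
  \<comment> \<open>The shift is written as a sum so that \<open>DERIV_shift\<close> applies
    literally.\<close>
  define R where "R z = theta_prod t (z + (- (1/2)))" for z
  \<comment> \<open>The imaginary part forces n = 0, and 1/2 is not an integer.\<close>
  have half: "theta_prod t (1/2) \<noteq> 0"
  proof
    assume "theta_prod t (1/2) = 0"
    then obtain m n :: int where mn: "1/2 = of_int m + of_int n * t"
      using theta_prod_eq_0D[OF t] by blast
    then have "n = 0" using t by (simp add: complex_eq_iff)
    with mn have "of_int (2 * m) = (of_int 1 :: complex)" by (simp add: mult.commute)
    then have "2 * m = 1" by (simp only: of_int_eq_iff)
    then show False by presburger
  qed
  have hH: "H holomorphic_on UNIV"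
    unfolding H_def by (intro holomorphic_intros G holomorphic_theta_prod t)
  have hR: "R holomorphic_on UNIV"
    unfolding R_def
    by (rule holomorphic_on_compose_gen[OF _ holomorphic_theta_prod[OF t], unfolded o_def])
       (auto intro!: holomorphic_intros)
  have H1: "H (z + 1) = H z" for z
    by (simp add: H_def G1 theta_prod_add_1)
  have Ht: "H (z + t) = - ee (- z) * H z" for z
    by (simp only: H_def Gt theta_prod_add_period[OF t]) (simp add: algebra_simps)
  have H0: "(H (z + t) = 0) = (H z = 0)" for z
    by (simp add: Ht)
  have "H (1/2) = 0"
    using half by (simp add: H_def c_def)
  then have H_zero: "H (1/2 + of_int m + of_int n * t) = 0" for m n
    using invariant_under_lattice[of "\<lambda>z. H z = 0" t "1/2" m n] H1 H0 by simp
  have "\<exists>E. E holomorphic_on UNIV \<and> (\<forall>z. H z = E z * R z)"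
  proof (rule entire_divide_simple_zeros[OF hH hR])
    fix z assume z: "R z = 0"
    have "(theta_prod t has_field_derivative deriv (theta_prod t) (z + (-(1/2)))) (at (z + (-(1/2))))"
      using holomorphic_derivI[OF holomorphic_theta_prod[OF t]] by auto
    then have "(R has_field_derivative deriv (theta_prod t) (z + (-(1/2)))) (at z)"
      unfolding R_def by (simp only: DERIV_shift)
    then show "deriv R z \<noteq> 0"
      using deriv_theta_prod[OF t, of "z + (-(1/2))"] z by (simp add: R_def DERIV_imp_deriv)
    from z obtain m n :: int where "z + (- (1/2)) = of_int m + of_int n * t"
      using theta_prod_eq_0D[OF t] unfolding R_def by blast
    then have "z = 1/2 + of_int m + of_int n * t"
      by (simp add: algebra_simps)
    then show "H z = 0"
      using H_zero by simp
  qed blast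
  then obtain E where E: "E holomorphic_on UNIV" "\<And>z. H z = E z * R z" by blast
  have R1: "R (z + 1) = R z" for z
    using theta_prod_add_1[of t "z + (-(1/2))"] by (simp add: R_def add_ac)
  have Rt: "R (z + t) = ee (- z) * R z" for z
  proof -
    have "ee (- (z + (-(1/2)))) = ee (1/2 - z)" by simp
    also have "\<dots> = - ee (- z)" by (simp only: ee_diff ee_minus ee_half) (simp add: divide_inverse)
    finally have "ee (- (z + (-(1/2)))) = - ee (- z)" .
    moreover have "z + t + (-(1/2)) = z + (-(1/2)) + t" by simp
    ultimately show ?thesis
      using theta_prod_add_period[OF t, of "z + (-(1/2))"] unfolding R_def by (metis minus_minus)
  qed
  have hE: "continuous_on UNIV E"
    using E(1) by (rule holomorphic_on_imp_continuous_on)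
  have hE': "continuous_on UNIV (\<lambda>z. E (z + a))" for a
    by (intro continuous_on_compose2[OF hE] continuous_intros) auto
  \<comment> \<open>R(1) is P(1/2), already known to be nonzero; cancelling R requires one such
    point.\<close>
  have Rnz: "R 1 \<noteq> 0"
    using half by (simp add: R_def)
  have E1: "E (z + 1) = E z" for z
  proof (rule continuous_mult_entire_cancel[OF hE' hE hR Rnz])
    show "E (w + 1) * R w = E w * R w" for w
      using H1[of w] by (simp add: E(2) R1)
  qed
  have Et: "E (z + t) = - E z" for z
  proof (rule continuous_mult_entire_cancel[OF hE' _ hR Rnz])
    show "E (w + t) * R w = - E w * R w" for w
    proof -
      have "ee (- w) * (E (w + t) * R w) = ee (- w) * (- E w * R w)"
        using Ht[of w] by (simp add: E(2) Rt mult_ac)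
      then show ?thesis by (simp only: mult_left_cancel[OF ee_nonzero])
    qed
  qed (intro continuous_intros hE)
  obtain b where b: "\<And>z. E z = b"
    using entire_norm_doubly_periodic_imp_const[OF t E(1)] E1 Et by fastforce
  with Et[of 0] have "b = 0" by simp
  then show ?thesis
    using E(2) b by (intro exI[of _ c]) (simp add: H_def)
qed

section \<open>The classical theta series and its comparison with the theta product\<close>

definition jtheta :: "complex \<Rightarrow> complex \<Rightarrow> complex" where
  "jtheta t w = (\<Sum>\<^sub>\<infinity>n\<in>(UNIV::int set). ee (of_int n ^ 2 * t / 2 + of_int n * w))"

lemma summable_on_power_abs_int:
  fixes c :: real
  assumes "0 \<le> c" "c < 1"
  shows "(\<lambda>n::int. c ^ nat \<bar>n\<bar>) summable_on UNIV"
proof -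
  have geo: "(\<lambda>n::nat. c ^ n) summable_on UNIV"
    using assms by (intro norm_summable_imp_summable_on) (auto intro!: summable_geometric)
  have "bij_betw int UNIV {0..}"
    by (rule bij_betw_byWitness[where f' = nat]) auto
  from summable_on_reindex_bij_betw[OF this, of "\<lambda>n. c ^ nat \<bar>n\<bar>"] geo
  have 1: "(\<lambda>n::int. c ^ nat \<bar>n\<bar>) summable_on {0..}" by simp
  have "bij_betw (\<lambda>n. - int n) UNIV {..0}"
    by (rule bij_betw_byWitness[where f' = "\<lambda>n. nat (-n)"]) auto
  from summable_on_reindex_bij_betw[OF this, of "\<lambda>n. c ^ nat \<bar>n\<bar>"] geo
  have "(\<lambda>n::int. c ^ nat \<bar>n\<bar>) summable_on {..0}" by simp
  then have 2: "(\<lambda>n::int. c ^ nat \<bar>n\<bar>) summable_on {..<0}"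
    by (rule summable_on_subset_banach) auto
  have "(\<lambda>n::int. c ^ nat \<bar>n\<bar>) summable_on ({0..} \<union> {..<0})"
    using 1 2 by (rule summable_on_Un_disjoint) auto
  moreover have "{0..} \<union> {..<0} = (UNIV :: int set)" by auto
  ultimately show ?thesis by simp
qed

lemma gaussian_summable_on_int:
  fixes y r :: real
  assumes y: "y > 0"
  shows "(\<lambda>n::int. exp (- y * of_int n ^ 2 + r * \<bar>of_int n\<bar>)) summable_on UNIV"
proof (rule summable_on_comparison_test)
  \<comment> \<open>The maximum of (r + 1) x - y x^2 over real x, found by completing the square. It
    bounds the exponent by K - x and so reduces the claim to a geometric series.\<close>
  define K where "K = (r + 1) ^ 2 / (4 * y)"
  have "(\<lambda>n::int. exp (- 1 :: real) ^ nat \<bar>n\<bar>) summable_on UNIV"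
    by (rule summable_on_power_abs_int) auto
  then show "(\<lambda>n::int. exp K * exp (- 1 :: real) ^ nat \<bar>n\<bar>) summable_on UNIV"
    by (rule summable_on_cmult_right)
  fix n :: int
  define x :: real where "x = \<bar>of_int n\<bar>"
  have "0 \<le> (2 * y * x - (r + 1))\<^sup>2 / (4 * y)"
    using y by simp
  also have "\<dots> = y * x\<^sup>2 - (r + 1) * x + K"
    using y by (simp add: K_def field_simps power2_eq_square)
  finally have "- y * x\<^sup>2 + r * x \<le> K - x" by (simp add: algebra_simps)
  then have "exp (- y * x\<^sup>2 + r * x) \<le> exp (K - x)" by simp
  also have "\<dots> = exp K * exp (- 1) ^ nat \<bar>n\<bar>"
    by (simp add: exp_diff x_def exp_of_nat_mult [symmetric] exp_minus field_simps)
  finally show "exp (- y * of_int n ^ 2 + r * \<bar>of_int n\<bar>) \<le> exp K * exp (- 1) ^ nat \<bar>n\<bar>"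
    by (simp add: x_def)
qed auto

context
  fixes t :: complex
  assumes t: "Im t > 0"
begin

lemma jtheta_uniform_limit:
  "uniform_limit (cball 0 r) (\<lambda>A w. \<Sum>n\<in>A. ee (of_int n ^ 2 * t / 2 + of_int n * w)) (jtheta t)
     (finite_subsets_at_top UNIV)"
  unfolding jtheta_def [abs_def]
proof (rule Weierstrass_m_test_general)
  show "(\<lambda>n::int. exp (- (pi * Im t) * of_int n ^ 2 + (2 * pi * r) * \<bar>of_int n\<bar>)) summable_on UNIV"
    using t by (intro gaussian_summable_on_int) auto
  fix n :: int and w :: complex assume w: "w \<in> cball 0 r"
  have "- (real_of_int n * Im w) \<le> \<bar>of_int n\<bar> * \<bar>Im w\<bar>"
    by (metis abs_ge_minus_self abs_mult)
  also have "\<dots> \<le> \<bar>of_int n\<bar> * r"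
    using w abs_Im_le_cmod[of w] by (intro mult_left_mono) auto
  finally have "2 * pi * (- (real_of_int n * Im w)) \<le> 2 * pi * (\<bar>of_int n\<bar> * r)"
    by (intro mult_left_mono) auto
  moreover have "Im (of_int n ^ 2 * t / 2) = of_int n ^ 2 * Im t / 2"
    by (simp add: power2_eq_square)
  ultimately show "norm (ee (of_int n ^ 2 * t / 2 + of_int n * w))
     \<le> exp (- (pi * Im t) * of_int n ^ 2 + (2 * pi * r) * \<bar>of_int n\<bar>)"
    by (simp add: norm_ee algebra_simps)
qed

lemma holomorphic_jtheta: "jtheta t holomorphic_on UNIV"
proof -
  have "jtheta t holomorphic_on ball 0 r" for r
    by (rule holomorphic_uniform_limit[OF _ jtheta_uniform_limit[of r]])
       (auto intro!: always_eventually holomorphic_intros continuous_intros)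
  then have "jtheta t analytic_on {z}" for z
    using analytic_at_ball[of "jtheta t" z]
    by (metis analytic_at centre_in_ball gt_ex mem_ball_0 open_ball)
  then show ?thesis
    using analytic_on_analytic_at analytic_imp_holomorphic by blast
qed

text \<open>The constant Fourier coefficient of \<open>jtheta t\<close> is \<open>1\<close>.\<close>

lemma jtheta_nonzero: "\<exists>w. jtheta t w \<noteq> 0"
proof (rule ccontr)
  assume "\<nexists>w. jtheta t w \<noteq> 0"
  then have J0: "jtheta t = (\<lambda>_. 0)" by auto
  define F where "F A x = (\<Sum>n\<in>A. ee (of_int n ^ 2 * t / 2 + of_int n * of_real x))" for A and x :: real
  have "uniform_limit {0..1} F (\<lambda>_. 0) (finite_subsets_at_top UNIV)"
    using jtheta_uniform_limit[of 1] unfolding J0 uniform_limit_iff F_def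
    by (elim all_forward imp_forward eventually_mono) auto
  moreover have "continuous_on {0..1} (F A)" for A
    unfolding F_def by (intro continuous_intros)
  \<comment> \<open>Uniform convergence allows integrating term by term over [0, 1]. Only the term n
    = 0 contributes, so I A = 1 as soon as A contains 0, while the vanishing limit function has
    integral J = 0.\<close>
  ultimately obtain I J where I: "\<And>A. (F A has_integral I A) {0..1}"
    and J: "((\<lambda>_. 0) has_integral J) {0..1::real}" and IJ: "(I \<longlongrightarrow> J) (finite_subsets_at_top UNIV)"
    by (rule uniform_limit_integral) auto
  have int: "((\<lambda>x::real. ee (of_int n ^ 2 * t / 2 + of_int n * of_real x)) has_integral
         (if n = 0 then 1 else 0)) {0..1}" for n :: int
  proof (cases "n = 0")
    case False
    define g where "g x = ee (of_int n ^ 2 * t / 2 + of_int n * x) / (2 * of_real pi * \<i> *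
        of_int n)" for x
    have "((\<lambda>x::real. ee (of_int n ^ 2 * t / 2 + of_int n * of_real x)) has_integral
             (g (of_real 1) - g (of_real 0))) {0..1}"
    proof (rule fundamental_theorem_of_calculus)
      fix x :: real
      have "(g has_field_derivative ee (of_int n ^ 2 * t / 2 + of_int n * of_real x)) (at (of_real x))"
        unfolding g_def ee_def using False by (auto intro!: derivative_eq_intros simp: field_simps)
      then show "((\<lambda>x. g (of_real x)) has_vector_derivative ee (of_int n ^ 2 * t / 2 + of_int n *
          of_real x)) (at x within {0..1})"
        using has_vector_derivative_real_field has_vector_derivative_at_within by blast
    qed auto
    moreover have "g 1 = g 0"
      by (simp add: g_def ee_add)
    ultimately show ?thesis using False by simp
  qed (use has_integral_const_real[of "1::complex" 0 1] in auto)
  have "I A = (if 0 \<in> A then 1 else 0)" if "finite A" for A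
  proof -
    have "(F A has_integral (\<Sum>n\<in>A. if n = 0 then 1 else 0)) {0..1}"
      unfolding F_def by (intro has_integral_sum that int)
    then have "I A = (\<Sum>n\<in>A. if n = 0 then 1 else 0)"
      using I has_integral_unique by blast
    then show ?thesis using that by simp
  qed
  then have "eventually (\<lambda>A. I A = 1) (finite_subsets_at_top UNIV)"
    unfolding eventually_finite_subsets_at_top by (intro exI[of _ "{0}"]) auto
  then have "(I \<longlongrightarrow> 1) (finite_subsets_at_top UNIV)"
    by (rule tendsto_eventually)
  moreover have "J = 0"
    using J has_integral_unique has_integral_0 by blast
  ultimately show False
    using IJ tendsto_unique[OF finite_subsets_at_top_neq_bot] by fastforce
qed

lemma jtheta_add_1: "jtheta t (w + 1) = jtheta t w"
  by (simp add: jtheta_def distrib_left ee_add add.assoc [symmetric])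

text \<open>Completing the square: n^2 t/2 + n t = (n + 1)^2 t/2 - t/2, followed by the substitution
  n + 1 for n.\<close>

lemma jtheta_add_period: "jtheta t (w + t) = ee (- t / 2 - w) * jtheta t w"
proof -
  have bij: "bij (\<lambda>n::int. n + 1)"
    by (rule bij_betw_byWitness[where f' = "\<lambda>n. n - 1"]) auto
  have "jtheta t (w + t) = (\<Sum>\<^sub>\<infinity>n. ee (- t / 2 - w) * ee (of_int (n + 1) ^ 2 * t / 2 + of_int (n +
      1) * w))"
    unfolding jtheta_def ee_add [symmetric]
    by (intro infsum_cong arg_cong[of _ _ ee]) (simp add: algebra_simps power2_eq_square
        add_divide_distrib)
  also have "\<dots> = ee (- t / 2 - w) * (\<Sum>\<^sub>\<infinity>n. ee (of_int (n + 1) ^ 2 * t / 2 + of_int (n + 1) * w))"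
    by (rule infsum_cmult_right')
  also have "(\<Sum>\<^sub>\<infinity>n. ee (of_int (n + 1) ^ 2 * t / 2 + of_int (n + 1) * w)) = jtheta t w"
    unfolding jtheta_def by (rule infsum_reindex_bij_betw[OF bij])
  finally show ?thesis .
qed

text \<open>The triple product identity with its constant left undetermined. Moving the argument by
  (t - 1)/2 turns the multiplier e(-t/2 - w) of the series into the multiplier -e(-z) of the
  product.\<close>

lemma jtheta_eq_theta_prod:
  obtains c where "c \<noteq> 0" "\<And>w. jtheta t w = c * theta_prod t (w + (t - 1) / 2)"
proof -
  define G where "G w = jtheta t (w - (t - 1) / 2)" for w
  have "\<exists>c. \<forall>z. G z = c * theta_prod t z"
  proof (rule theta_prod_unique[OF t])
    show "G holomorphic_on UNIV"
      unfolding G_def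
      by (rule holomorphic_on_compose_gen[OF _ holomorphic_jtheta, unfolded o_def])
         (auto intro!: holomorphic_intros)
    show "G (z + 1) = G z" for z
      using jtheta_add_1[of "z - (t - 1) / 2"] by (simp add: G_def algebra_simps)
    show "G (z + t) = - ee (- z) * G z" for z
    proof -
      have "- t / 2 - (z - (t - 1) / 2) = - z - 1 / 2" by (simp add: field_simps)
      then have "ee (- t / 2 - (z - (t - 1) / 2)) = - ee (- z)"
        by (simp only: ee_diff ee_half) simp
      moreover have "z + t - (t - 1) / 2 = z - (t - 1) / 2 + t" by simp
      ultimately show ?thesis
        using jtheta_add_period[of "z - (t - 1) / 2"] unfolding G_def by metis
    qed
  qed
  then obtain c where c: "\<And>z. G z = c * theta_prod t z" by blast
  have "jtheta t w = c * theta_prod t (w + (t - 1) / 2)" for w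
    using c[of "w + (t - 1) / 2"] by (simp add: G_def)
  moreover from this have "c \<noteq> 0"
    using jtheta_nonzero by auto
  ultimately show ?thesis using that by blast
qed

end

section \<open>The functions \<open>\<theta>\<^sub>k\<close>\<close>

definition theta_char :: "nat \<Rightarrow> int \<Rightarrow> complex" where
  "theta_char N k = 1 / 2 - of_int k / of_nat N"

text \<open>With a = \<open>theta_char N k\<close>, the k-th series runs over n + a. Expanding (n +
  a)^2, these are the terms of the exponent free of n; the others form a \<open>jtheta\<close> with
  parameter N tau.\<close>

definition theta_prefactor :: "nat \<Rightarrow> complex \<Rightarrow> int \<Rightarrow> complex \<Rightarrow> complex" where
  "theta_prefactor N \<tau> k z =
     ee (of_nat N * theta_char N k ^ 2 * \<tau> / 2 + of_nat N * theta_char N k * (z + 1/2))"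

text \<open>The multipliers are those shared by all theta_k. Division by theta_0 will carry this
  space onto the space L^1 of the theorem.\<close>

definition theta_space :: "nat \<Rightarrow> complex \<Rightarrow> (complex \<Rightarrow> complex) set" where
  "theta_space N \<tau> = {g. g holomorphic_on UNIV \<and> (\<forall>z. g (z + 1) = ee (of_nat N / 2) * g z) \<and>
     (\<forall>z. g (z + \<tau>) = ee (- of_nat N * \<tau> / 2 - of_nat N * (z + 1/2)) * g z)}"

text \<open>The zeros of \<open>\<theta>\<^sub>k\<close> are the translates of \<open>theta_offset N + k S\<close> by multiples of \<open>T\<close>. Modulo
  these multiples, \<open>theta_offset N\<close> is \<open>0\<close> for odd \<open>N\<close> and \<open>1 / (2 N)\<close> for even \<open>N\<close>.\<close>

definition theta_offset :: "nat \<Rightarrow> complex" where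
  "theta_offset N = (1 - of_nat N) / (2 * of_nat N)"

text \<open>The bound on l suits differences of two indices from 0, ..., N - 1. It is used once for
  orthogonality of the eigenfunctions and once for inversion.\<close>

lemma sum_roots_of_unity_nat:
  assumes "N > 0" "\<bar>l\<bar> < int N"
  shows "(\<Sum>m<N. ee (of_int l * of_nat m / of_nat N)) = (if l = 0 then of_nat N else 0)"
proof (cases "l = 0")
  case False
  define x where "x = ee (of_int l / of_nat N)"
  have "x \<noteq> 1"
  proof
    assume "x = 1"
    then obtain n :: int where "of_int l / of_nat N = (of_int n :: complex)"
      by (auto simp: x_def ee_eq_1_iff elim: Ints_cases)
    then have "of_int l = (of_int (n * int N) :: complex)"
      using assms(1) by (simp add: field_simps)
    then have "l = n * int N" by (simp only: of_int_eq_iff)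
    with assms(2) False show False
      by (simp add: abs_mult)
  qed
  moreover have "x ^ N = 1"
    using assms(1) by (simp add: x_def ee_power)
  moreover have "ee (of_int l * of_nat m / of_nat N) = x ^ m" for m
    by (simp add: x_def ee_power algebra_simps)
  ultimately show ?thesis
    using False by (simp add: sum_gp_strict)
qed auto

lemma sum_int_interval_eq_sum_nat: "(\<Sum>j=0..<int N. f j) = (\<Sum>m<N. f (int m))"
  by (rule sum.reindex_bij_witness[of _ int nat]) auto


text \<open>The projection to the \<open>\<zeta>\<^sub>N\<^sup>j\<close>-eigenspace of the operator \<open>g(z) \<mapsto> - g(z - 1/N)\<close>, which has order
  dividing \<open>N\<close> on functions with \<open>g(z + 1) = (-1)\<^sup>N g(z)\<close>.\<close>

definition theta_proj :: "nat \<Rightarrow> int \<Rightarrow> (complex \<Rightarrow> complex) \<Rightarrow> complex \<Rightarrow> complex" where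
  "theta_proj N j g z =
     (\<Sum>m<N. ee (- (of_int j / of_nat N + 1/2) * of_nat m) * g (z - of_nat m / of_nat N)) / of_nat N"

context
  fixes N :: nat and \<tau> :: complex
  assumes N: "N > 0" and \<tau>: "Im \<tau> > 0"
begin

lemma Im_N_tau: "Im (of_nat N * \<tau>) > 0"
  using N \<tau> by simp

lemma theta_eq_jtheta:
  "theta N \<tau> k z = theta_prefactor N \<tau> k z *
     jtheta (of_nat N * \<tau>) (of_nat N * z + of_nat N / 2 + of_nat N * theta_char N k * \<tau>)"
proof -
  have "theta N \<tau> k z = (\<Sum>\<^sub>\<infinity>n::int. theta_prefactor N \<tau> k z *
      ee (of_int n ^ 2 * (of_nat N * \<tau>) / 2
        + of_int n * (of_nat N * z + of_nat N / 2 + of_nat N * theta_char N k * \<tau>)))"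
    unfolding theta_def theta_prefactor_def ee_add [symmetric]
  proof (intro infsum_cong arg_cong[of _ _ ee])
    fix n :: int
    have *: "of_int n - of_int k / of_nat N + 1/2 = of_int n + theta_char N k"
      by (simp add: theta_char_def)
    show "1/2 * of_nat N * (of_int n - of_int k / of_nat N + 1/2)^2 * \<tau>
            + of_nat N * (of_int n - of_int k / of_nat N + 1/2) * (z + 1/2) =
          of_nat N * (theta_char N k)\<^sup>2 * \<tau> / 2 + of_nat N * theta_char N k * (z + 1/2) +
          ((of_int n)\<^sup>2 * (of_nat N * \<tau>) / 2 +
          of_int n * (of_nat N * z + of_nat N / 2 + of_nat N * theta_char N k * \<tau>))"
      unfolding * by (simp add: field_simps power2_eq_square)
  qed
  then show ?thesis
    by (simp only: jtheta_def infsum_cmult_right')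
qed

lemma N_theta_char: "of_nat N * theta_char N k = of_nat N / 2 - of_int k"
  using N by (simp add: theta_char_def field_simps)

lemma theta_prefactor_nonzero [simp]: "theta_prefactor N \<tau> k z \<noteq> 0"
  by (simp add: theta_prefactor_def)

lemma theta_prefactor_add:
  "theta_prefactor N \<tau> k (z + w) = ee (of_nat N * theta_char N k * w) * theta_prefactor N \<tau> k z"
  by (simp add: theta_prefactor_def ee_add [symmetric] algebra_simps)

lemma holomorphic_theta_prefactor: "theta_prefactor N \<tau> k holomorphic_on UNIV"
  unfolding theta_prefactor_def [abs_def] by (intro holomorphic_intros)

text \<open>One constant c serves all k, since it belongs to \<open>jtheta\<close> with parameter N
  tau and k only moves the argument.\<close>

lemma theta_eq_theta_prod:
  obtains c where "c \<noteq> 0"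
    "\<And>k z. theta N \<tau> k z = c * theta_prefactor N \<tau> k z *
       theta_prod (of_nat N * \<tau>) (of_nat N * z + ((of_nat N - 1) / 2 + of_nat N * \<tau> - of_int k * \<tau>))"
proof -
  obtain c where c: "c \<noteq> 0" "\<And>w. jtheta (of_nat N * \<tau>) w =
      c * theta_prod (of_nat N * \<tau>) (w + (of_nat N * \<tau> - 1) / 2)"
    using jtheta_eq_theta_prod[OF Im_N_tau] by blast
  have eq: "of_nat N * z + of_nat N / 2 + of_nat N * theta_char N k * \<tau> + (of_nat N * \<tau> - 1) / 2 =
     of_nat N * z + ((of_nat N - 1) / 2 + of_nat N * \<tau> - of_int k * \<tau>)" for k z
    unfolding N_theta_char by (simp add: field_simps)
  have "theta N \<tau> k z = c * theta_prefactor N \<tau> k z *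
       theta_prod (of_nat N * \<tau>) (of_nat N * z + ((of_nat N - 1) / 2 + of_nat N * \<tau> - of_int k *
           \<tau>))" for k z
    unfolding theta_eq_jtheta c(2) eq by (simp only: mult_ac)
  with c(1) show ?thesis by (rule that)
qed

lemma holomorphic_theta: "theta N \<tau> k holomorphic_on UNIV"
proof -
  obtain c where c: "\<And>k z. theta N \<tau> k z = c * theta_prefactor N \<tau> k z *
       theta_prod (of_nat N * \<tau>) (of_nat N * z + ((of_nat N - 1) / 2 + of_nat N * \<tau> - of_int k * \<tau>))"
    using theta_eq_theta_prod by blast
  show ?thesis
    unfolding c [abs_def]
    by (intro holomorphic_intros holomorphic_theta_prefactor
          holomorphic_on_compose_gen[OF _ holomorphic_theta_prod[OF Im_N_tau], unfolded o_def]) auto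
qed

lemma theta_eq_0_iff:
  "theta N \<tau> k z = 0 \<longleftrightarrow>
     (\<exists>m n::int. z = theta_offset N + of_int k * \<tau> / of_nat N + of_int m / of_nat N + of_int n * \<tau>)"
proof -
  obtain c where c: "c \<noteq> 0" "\<And>k z. theta N \<tau> k z = c * theta_prefactor N \<tau> k z *
       theta_prod (of_nat N * \<tau>) (of_nat N * z + ((of_nat N - 1) / 2 + of_nat N * \<tau> - of_int k * \<tau>))"
    using theta_eq_theta_prod by blast
  \<comment> \<open>The index n - 1 absorbs the summand N tau in the argument of the product; it is
    renamed to n below.\<close>
  have eq: "of_nat N * z + ((of_nat N - 1) / 2 + of_nat N * \<tau> - of_int k * \<tau>) =
      of_int m + of_int n * (of_nat N * \<tau>)
    \<longleftrightarrow> z = theta_offset N + of_int k * \<tau> / of_nat N + of_int m / of_nat N + of_int (n - 1) * \<tau>"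
        for m n :: int
    using N by (simp add: theta_offset_def field_simps)
  have "theta N \<tau> k z = 0 \<longleftrightarrow> (\<exists>m n::int. z = theta_offset N + of_int k * \<tau> / of_nat N +
      of_int m / of_nat N + of_int (n - 1) * \<tau>)"
    using c(1) by (simp add: c(2) theta_prod_eq_0_iff[OF Im_N_tau] eq del: of_int_diff)
  also have "\<dots> \<longleftrightarrow> (\<exists>m n::int. z = theta_offset N + of_int k * \<tau> / of_nat N + of_int m / of_nat N +
      of_int n * \<tau>)"
    by (metis add_diff_cancel_right')
  finally show ?thesis .
qed

lemma deriv_theta:
  assumes "theta N \<tau> k z = 0"
  shows "deriv (theta N \<tau> k) z \<noteq> 0"
proof -
  obtain c where c: "c \<noteq> 0" "\<And>k z. theta N \<tau> k z = c * theta_prefactor N \<tau> k z *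
       theta_prod (of_nat N * \<tau>) (of_nat N * z + ((of_nat N - 1) / 2 + of_nat N * \<tau> - of_int k * \<tau>))"
    using theta_eq_theta_prod by blast
  define b where "b = (of_nat N - 1) / 2 + of_nat N * \<tau> - of_int k * \<tau>"
  define P where "P = theta_prod (of_nat N * \<tau>)"
  note c' = c(2)[of k, folded b_def P_def]
  have P0: "P (of_nat N * z + b) = 0"
    using assms c(1) by (simp add: c')
  have P: "(P has_field_derivative deriv P w) (at w)" for w
    unfolding P_def using holomorphic_derivI[OF holomorphic_theta_prod[OF Im_N_tau]] by auto
  have E: "(theta_prefactor N \<tau> k has_field_derivative deriv (theta_prefactor N \<tau> k) z) (at z)"
    using holomorphic_derivI[OF holomorphic_theta_prefactor] by auto
  have Q: "((\<lambda>z. P (of_nat N * z + b)) has_field_derivative deriv P (of_nat N * z + b) *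
      of_nat N) (at z)"
    by (rule DERIV_chain2[OF P]) (auto intro!: derivative_eq_intros)
  have "((\<lambda>z. c * theta_prefactor N \<tau> k z * P (of_nat N * z + b)) has_field_derivative
          c * theta_prefactor N \<tau> k z * (deriv P (of_nat N * z + b) * of_nat N)) (at z)"
    by (rule derivative_eq_intros E Q | simp add: P0)+
  then have "deriv (theta N \<tau> k) z = c * theta_prefactor N \<tau> k z * (deriv P (of_nat N * z + b) *
      of_nat N)"
    unfolding c' [abs_def] by (rule DERIV_imp_deriv)
  then show ?thesis
    using c(1) N deriv_theta_prod[OF Im_N_tau] P0 unfolding P_def by simp
qed

text \<open>The zero function would have a zero at which its derivative vanishes too.\<close>

lemma theta_nonzero: "\<exists>z. theta N \<tau> k z \<noteq> 0"
proof (rule ccontr)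
  assume "\<nexists>z. theta N \<tau> k z \<noteq> 0"
  then have "theta N \<tau> k = (\<lambda>_. 0)" by auto
  with deriv_theta[of k 0] show False by simp
qed

lemma zorder_theta: "zorder (theta N \<tau> k) z = (if theta N \<tau> k z = 0 then 1 else 0)"
proof (cases "theta N \<tau> k z = 0")
  case True
  have "zorder (theta N \<tau> k) z = 1"
    by (rule zorder_zero_eqI[OF holomorphic_theta]) (use True deriv_theta in auto)
  with True show ?thesis by simp
next
  case False
  have "zorder (theta N \<tau> k) z = 0"
    by (rule zorder_zero_eqI[OF holomorphic_theta]) (use False in auto)
  with False show ?thesis by simp
qed

text \<open>The dependence on k cancels: under z + 1 the prefactor gains e(N/2 - k) = e(N/2), and
  under z + tau its gain e(N a tau), where a = \<open>theta_char N k\<close>, is undone by the term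
  N a tau in the argument of \<open>jtheta\<close>.\<close>

lemma theta_in_theta_space: "theta N \<tau> k \<in> theta_space N \<tau>"
proof -
  define w where "w z = of_nat N * z + of_nat N / 2 + of_nat N * theta_char N k * \<tau>" for z
  have 1: "theta N \<tau> k (z + 1) = ee (of_nat N / 2) * theta N \<tau> k z" for z
  proof -
    have "jtheta (of_nat N * \<tau>) (x + of_nat n) = jtheta (of_nat N * \<tau>) x" for x n
    proof (induction n)
      case (Suc n)
      then show ?case using jtheta_add_1[OF Im_N_tau, of "x + of_nat n"] by (simp add: add_ac)
    qed auto
    from this[of "w z" N] have "jtheta (of_nat N * \<tau>) (w (z + 1)) = jtheta (of_nat N * \<tau>) (w z)"
      by (simp add: w_def algebra_simps)
    moreover have "ee (of_nat N * theta_char N k * 1) = ee (of_nat N / 2)"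
      by (simp add: N_theta_char ee_diff)
    ultimately show ?thesis
      by (simp only: theta_eq_jtheta theta_prefactor_add w_def mult.assoc)
  qed
  have "theta N \<tau> k (z + \<tau>) = ee (- of_nat N * \<tau> / 2 - of_nat N * (z + 1/2)) * theta N \<tau> k z" for z
  proof -
    have "w (z + \<tau>) = w z + of_nat N * \<tau>"
      by (simp add: w_def algebra_simps)
    then have "jtheta (of_nat N * \<tau>) (w (z + \<tau>)) = ee (- (of_nat N * \<tau>) / 2 - w z) *
        jtheta (of_nat N * \<tau>) (w z)"
      by (simp only: jtheta_add_period[OF Im_N_tau])
    then have "theta N \<tau> k (z + \<tau>) = (ee (of_nat N * theta_char N k * \<tau>) * ee (- (of_nat N *
        \<tau>) / 2 - w z)) * theta N \<tau> k z"
      by (simp only: theta_eq_jtheta theta_prefactor_add w_def) (simp only: mult_ac)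
    also have "ee (of_nat N * theta_char N k * \<tau>) * ee (- (of_nat N * \<tau>) / 2 - w z) =
        ee (- of_nat N * \<tau> / 2 - of_nat N * (z + 1/2))"
      unfolding ee_add [symmetric] w_def by (intro arg_cong[of _ _ ee]) (simp add: algebra_simps)
    finally show ?thesis .
  qed
  with 1 show ?thesis
    by (auto simp: theta_space_def holomorphic_theta)
qed

text \<open>The argument of \<open>jtheta\<close> moves by the integer m, so only the prefactor
  changes. For m = 1 the factor is -zeta_N^k, the eigenvalue that separates the theta_k; all m occur
  in \<open>theta_proj\<close>.\<close>

lemma theta_diff_T: "theta N \<tau> k (z - of_nat m / of_nat N) =
    ee ((of_int k / of_nat N + 1/2) * of_nat m) * theta N \<tau> k z"
proof -
  define w where "w z = of_nat N * z + of_nat N / 2 + of_nat N * theta_char N k * \<tau>" for z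
  have per: "jtheta (of_nat N * \<tau>) (x - of_nat n) = jtheta (of_nat N * \<tau>) x" for x n
  proof (induction n)
    case (Suc n)
    then show ?case using jtheta_add_1[OF Im_N_tau, of "x - of_nat (Suc n)"]
        by (simp add: algebra_simps)
  qed auto
  have "w (z - of_nat m / of_nat N) = w z - of_nat m"
    using N by (simp add: w_def field_simps)
  then have 1: "jtheta (of_nat N * \<tau>) (w (z - of_nat m / of_nat N)) = jtheta (of_nat N * \<tau>) (w z)"
    using per by simp
  have 2: "ee (of_nat N * theta_char N k * (- (of_nat m / of_nat N))) =
      ee ((of_int k / of_nat N + 1/2) * of_nat m)"
  proof -
    have "of_nat N * theta_char N k * (- (of_nat m / of_nat N)) =
        (of_int k / of_nat N + 1/2) * of_nat m - of_nat m"
      unfolding N_theta_char using N by (simp add: field_simps)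
    then show ?thesis by (simp add: ee_diff)
  qed
  show ?thesis
    using 1 2 theta_prefactor_add[of k z "- (of_nat m / of_nat N)"]
    by (simp add: theta_eq_jtheta w_def)
qed

text \<open>Raising k by 1 lowers the characteristic by 1/N, which matches the translation by tau/N
  in the argument of \<open>jtheta\<close>. The exponential factor does not involve k, hence cancels
  in quotients of theta functions.\<close>

lemma theta_diff_S:
  "theta N \<tau> k (z - \<tau> / of_nat N) = ee (z + 1/2 - \<tau> / (2 * of_nat N)) * theta N \<tau> (k + 1) z"
proof -
  have char: "theta_char N k = theta_char N (k + 1) + 1 / of_nat N"
    using N by (simp add: theta_char_def field_simps)
  have "theta_prefactor N \<tau> k (z - \<tau> / of_nat N) = ee (z + 1/2 - \<tau> / (2 * of_nat N)) *
      theta_prefactor N \<tau> (k + 1) z"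
    unfolding theta_prefactor_def ee_add [symmetric] char
    by (intro arg_cong[of _ _ ee]) (use N in \<open>simp add: field_simps power2_eq_square\<close>)
  moreover have "of_nat N * (z - \<tau> / of_nat N) + of_nat N / 2 + of_nat N * theta_char N k * \<tau> =
     of_nat N * z + of_nat N / 2 + of_nat N * theta_char N (k + 1) * \<tau>"
    unfolding N_theta_char using N by (simp add: field_simps)
  ultimately show ?thesis by (simp only: theta_eq_jtheta mult.assoc)
qed

text \<open>The substitution of -n - 1 for n negates n + 1/2. What is left over is an integer plus
  N/2, so the sign is the same for all k and cancels in X_k.\<close>

lemma theta_minus: "theta N \<tau> k (- z) = ee (of_nat N / 2) * theta N \<tau> (- k) z"
proof -
  have bij: "bij (\<lambda>n::int. - n - 1)"
    by (rule bij_betw_byWitness[where f' = "\<lambda>n. - n - 1"]) auto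
  define f where "f k z n = 1/2 * of_nat N * (of_int n - of_int k / of_nat N + 1/2)^2 * \<tau>
            + of_nat N * (of_int n - of_int k / of_nat N + 1/2) * (z + 1/2)" for k :: int and z
                and n :: int
  have "theta N \<tau> k (- z) = (\<Sum>\<^sub>\<infinity>n. ee (f k (- z) (- n - 1)))"
    unfolding theta_def f_def [symmetric] by (rule infsum_reindex_bij_betw[OF bij, symmetric])
  also have "\<dots> = (\<Sum>\<^sub>\<infinity>n. ee (of_nat N / 2) * ee (f (- k) z n))"
  proof (rule infsum_cong)
    fix n :: int
    have "f k (- z) (- n - 1) = of_nat N / 2 + f (- k) z n - of_int (k + of_nat N * (n + 1))"
      unfolding f_def using N by (simp add: field_simps power2_eq_square)
    then show "ee (f k (- z) (- n - 1)) = ee (of_nat N / 2) * ee (f (- k) z n)"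
      by (simp only: ee_diff ee_add ee_of_int) simp
  qed
  also have "\<dots> = ee (of_nat N / 2) * theta N \<tau> (- k) z"
    unfolding theta_def f_def [symmetric] by (rule infsum_cmult_right')
  finally show ?thesis .
qed

text \<open>In the variable w = N z + b the translation by 1/N becomes w + 1 and tau becomes N tau.
  After division by the prefactor the eigenvalue condition says exactly that the function has period
  1 in w, so \<open>theta_prod_unique\<close> applies.\<close>

lemma theta_eigen_unique:
  assumes g: "g holomorphic_on UNIV"
    and gT: "\<And>z. g (z + 1 / of_nat N) = - ee (- of_int k / of_nat N) * g z"
    and gt: "\<And>z. g (z + \<tau>) = ee (- of_nat N * \<tau> / 2 - of_nat N * (z + 1/2)) * g z"
  shows "\<exists>c. \<forall>z. g z = c * theta N \<tau> k z"
proof -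
  \<comment> \<open>The constant in the argument of the product in
    \<open>theta_eq_theta_prod\<close>; u is the inverse of z -> N z + b.\<close>
  define b where "b = (of_nat N - 1) / 2 + of_nat N * \<tau> - of_int k * \<tau>"
  define u where "u w = (w - b) / of_nat N" for w
  have uw: "of_nat N * u w + b = w" for w
    using N by (simp add: u_def)
  define G where "G w = g (u w) / theta_prefactor N \<tau> k (u w)" for w
  have "\<exists>c. \<forall>w. G w = c * theta_prod (of_nat N * \<tau>) w"
  proof (rule theta_prod_unique[OF Im_N_tau])
    show "G holomorphic_on UNIV"
      unfolding G_def u_def using N
      by (intro holomorphic_intros holomorphic_on_compose_gen[OF _ g, unfolded o_def]
            holomorphic_on_compose_gen[OF _ holomorphic_theta_prefactor, unfolded o_def]) auto
    show "G (w + 1) = G w" for w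
    proof -
      have "u (w + 1) = u w + 1 / of_nat N"
        using N by (simp add: u_def field_simps)
      moreover have "of_nat N * theta_char N k * (1 / of_nat N) = 1/2 + - of_int k / of_nat N"
        using N by (simp add: theta_char_def)
      then have "ee (of_nat N * theta_char N k * (1 / of_nat N)) = - ee (- of_int k / of_nat N)"
        by (simp only: ee_add ee_half) simp
      ultimately show ?thesis
        by (simp only: G_def gT theta_prefactor_add) simp
    qed
    show "G (w + of_nat N * \<tau>) = - ee (- w) * G w" for w
    proof -
      have "u (w + of_nat N * \<tau>) = u w + \<tau>"
        using N by (simp add: u_def field_simps)
      then have "G (w + of_nat N * \<tau>) =
         (ee (- of_nat N * \<tau> / 2 - of_nat N * (u w + 1/2)) / ee (of_nat N * theta_char N k * \<tau>)) * G w"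
        by (simp only: G_def gt theta_prefactor_add) simp
      also have "ee (- of_nat N * \<tau> / 2 - of_nat N * (u w + 1/2)) / ee (of_nat N * theta_char N k *
          \<tau>) = ee (- w - 1/2)"
        unfolding ee_diff [symmetric] N_theta_char
        by (intro arg_cong[of _ _ ee], subst (2) uw [symmetric]) (simp add: b_def field_simps)
      also have "\<dots> = - ee (- w)"
        by (simp only: ee_diff ee_half) simp
      finally show ?thesis .
    qed
  qed
  then obtain c where c: "\<And>w. G w = c * theta_prod (of_nat N * \<tau>) w" by blast
  obtain d where d: "d \<noteq> 0" "\<And>k z. theta N \<tau> k z = d * theta_prefactor N \<tau> k z *
       theta_prod (of_nat N * \<tau>) (of_nat N * z + ((of_nat N - 1) / 2 + of_nat N * \<tau> - of_int k * \<tau>))"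
    using theta_eq_theta_prod by blast
  have "g z = c / d * theta N \<tau> k z" for z
  proof -
    have "u (of_nat N * z + b) = z" using N by (simp add: u_def)
    then have "g z = G (of_nat N * z + b) * theta_prefactor N \<tau> k z"
      by (simp add: G_def)
    also have "\<dots> = c / d * theta N \<tau> k z"
      using d(1) by (simp add: c d(2) b_def)
    finally show ?thesis .
  qed
  then show ?thesis by blast
qed

section \<open>Decomposition into eigenfunctions of the translation by 1/N\<close>

lemma theta_proj_theta:
  assumes "\<bar>k - j\<bar> < int N"
  shows "theta_proj N j (theta N \<tau> k) z = (if k = j then theta N \<tau> k z else 0)"
proof -
  have "ee (- (of_int j / of_nat N + 1/2) * of_nat m) * theta N \<tau> k (z - of_nat m / of_nat N) =
        ee (of_int (k - j) * of_nat m / of_nat N) * theta N \<tau> k z" for m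
  proof -
    have "- (of_int j / of_nat N + 1/2) * of_nat m + (of_int k / of_nat N + 1/2) * of_nat m =
        of_int (k - j) * of_nat m / (of_nat N :: complex)"
      using N by (simp add: field_simps)
    then show ?thesis
      unfolding theta_diff_T mult.assoc [symmetric] ee_add [symmetric] by (simp only:)
  qed
  then have "theta_proj N j (theta N \<tau> k) z = (\<Sum>m<N. ee (of_int (k - j) * of_nat m / of_nat N)) *
      theta N \<tau> k z / of_nat N"
    by (simp only: theta_proj_def sum_distrib_right)
  then show ?thesis
    using N by (simp only: sum_roots_of_unity_nat[OF N assms]) auto
qed

text \<open>Fourier inversion on Z/N, valid for an arbitrary function g: after exchanging the sums,
  the sum over j vanishes unless m = 0.\<close>

lemma sum_theta_proj: "(\<Sum>j=0..<int N. theta_proj N j g z) = g z"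
proof -
  define h where "h m = ee (- of_nat m / 2) * g (z - of_nat m / of_nat N)" for m
  have *: "ee (- (of_int j / of_nat N + 1/2) * of_nat m) * g (z - of_nat m / of_nat N) =
      ee (of_int (- int m) * of_int j / of_nat N) * h m" for m and j :: int
    unfolding h_def mult.assoc [symmetric] ee_add [symmetric]
    by (intro arg_cong2[of _ _ _ _ "(*)"] arg_cong[of _ _ ee] refl) (simp add: algebra_simps)
  have "(\<Sum>j=0..<int N. theta_proj N j g z) =
      (\<Sum>j<N. (\<Sum>m<N. ee (of_int (- int m) * of_nat j / of_nat N) * h m)) / of_nat N"
    unfolding theta_proj_def * sum_int_interval_eq_sum_nat by (simp add: sum_divide_distrib)
  also have "(\<Sum>j<N. (\<Sum>m<N. ee (of_int (- int m) * of_nat j / of_nat N) * h m)) =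
      (\<Sum>m<N. (\<Sum>j<N. ee (of_int (- int m) * of_nat j / of_nat N)) * h m)"
    by (subst sum.swap) (simp only: sum_distrib_right)
  also have "\<dots> = (\<Sum>m<N. if m = 0 then of_nat N * h m else 0)"
    by (intro sum.cong refl, subst sum_roots_of_unity_nat) (use N in auto)
  also have "\<dots> = of_nat N * h 0"
    using N by simp
  finally show ?thesis
    using N by (simp add: h_def)
qed

lemma theta_proj_multiple:
  assumes g: "g \<in> theta_space N \<tau>"
  shows "\<exists>c. \<forall>z. theta_proj N j g z = c * theta N \<tau> j z"
proof (rule theta_eigen_unique)
  have g_holo: "g holomorphic_on UNIV"
    and g1: "\<And>z. g (z + 1) = ee (of_nat N / 2) * g z"
    and gt: "\<And>z. g (z + \<tau>) = ee (- of_nat N * \<tau> / 2 - of_nat N * (z + 1/2)) * g z"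
    using g by (auto simp: theta_space_def)
  show "theta_proj N j g holomorphic_on UNIV"
    unfolding theta_proj_def [abs_def]
    by (intro holomorphic_intros holomorphic_on_compose_gen[OF _ g_holo, unfolded o_def]) (use N in
        auto)
  define a where "a = - (of_int j / of_nat N + 1/2 :: complex)"
  define F where "F z m = ee (a * of_nat m) * g (z - of_nat m / of_nat N)" for z m
  have proj: "theta_proj N j g z = (\<Sum>m<N. F z m) / of_nat N" for z
    by (simp add: theta_proj_def F_def a_def)
  have eea: "ee a = - ee (- of_int j / of_nat N)"
    unfolding a_def by (simp add: ee_diff)
  show "theta_proj N j g (z + 1 / of_nat N) = - ee (- of_int j / of_nat N) * theta_proj N j g z" for z
  proof -
    have step: "F (z + 1 / of_nat N) (Suc m) = ee a * F z m" for m
    proof -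
      have "z + 1 / of_nat N - of_nat (Suc m) / of_nat N = z - of_nat m / of_nat N"
        by (simp add: add_divide_distrib)
      then show ?thesis
        unfolding F_def by (simp only:) (simp add: distrib_left ee_add)
    qed
    \<comment> \<open>The cycle closes: the weight e(a N) = e(-N/2) compensates the multiplier
      e(N/2) of g under the period 1. Hence shifting m by one does not change the sum.\<close>
    have "F (z + 1 / of_nat N) N = F (z + 1 / of_nat N) 0"
    proof -
      have "ee (a * of_nat N) = ee (- (of_nat N / 2))"
      proof -
        have "a * of_nat N = - (of_nat N / 2) - of_int j"
          using N by (simp add: a_def field_simps)
        then show ?thesis by (simp add: ee_diff)
      qed
      moreover have "g (z + 1 / of_nat N) = ee (of_nat N / 2) * g (z + 1 / of_nat N - 1)"
        using g1[of "z + 1 / of_nat N - 1"] by simp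

      moreover have "ee (- (of_nat N / 2)) = ee (of_nat N / 2)"
      proof -
        have "- (of_nat N / 2) = of_nat N / 2 - (of_nat N :: complex)" by simp
        then show ?thesis by (simp only: ee_diff) simp
      qed
      ultimately show ?thesis
        using N by (simp add: F_def)
    qed
    then have "(\<Sum>m<N. F (z + 1 / of_nat N) m) = (\<Sum>m<N. F (z + 1 / of_nat N) (Suc m))"
      using sum.lessThan_Suc[of "F (z + 1 / of_nat N)"
          N] sum.lessThan_Suc_shift[of "F (z + 1 / of_nat N)" N] by simp
    then show ?thesis
      unfolding proj step eea by (simp add: sum_distrib_left [symmetric] sum_negf)
  qed
  show "theta_proj N j g (z + \<tau>) = ee (- of_nat N * \<tau> / 2 - of_nat N * (z + 1/2)) *
      theta_proj N j g z" for z
  proof -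
    have "F (z + \<tau>) m = ee (- of_nat N * \<tau> / 2 - of_nat N * (z + 1/2)) * F z m" for m
    proof -
      \<comment> \<open>Moving z by m/N changes the exponent by the integer m, so all summands share
        one multiplier under tau.\<close>
      have "ee (- of_nat N * \<tau> / 2 - of_nat N * (z - of_nat m / of_nat N + 1/2)) =
            ee (- of_nat N * \<tau> / 2 - of_nat N * (z + 1/2) + of_nat m)"
        using N by (intro arg_cong[of _ _ ee]) (simp add: field_simps)
      also have "\<dots> = ee (- of_nat N * \<tau> / 2 - of_nat N * (z + 1/2))"
        unfolding ee_add by simp
      finally show ?thesis
        using gt[of "z - of_nat m / of_nat N"] by (simp add: F_def algebra_simps)
    qed
    then show ?thesis
      unfolding proj by (simp add: sum_distrib_left)
  qed
qed

lemma theta_space_expand: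
  assumes "g \<in> theta_space N \<tau>"
  shows "\<exists>c. \<forall>z. g z = (\<Sum>j=0..<int N. c j * theta N \<tau> j z)"
proof -
  obtain c where "\<And>j z. theta_proj N j g z = c j * theta N \<tau> j z"
    using theta_proj_multiple[OF assms] by metis
  then show ?thesis
    using sum_theta_proj[of g] by (intro exI[of _ c]) simp
qed

lemma theta_lin_indep:
  assumes "\<And>z. (\<Sum>k=0..<int N. c k * theta N \<tau> k z) = 0" and j: "j \<in> {0..<int N}"
  shows "c j = 0"
proof -
  obtain z where z: "theta N \<tau> j z \<noteq> 0" using theta_nonzero by blast
  \<comment> \<open>The j-th projection kills every summand except the one with k = j.\<close>
  have "0 = theta_proj N j (\<lambda>z. \<Sum>k=0..<int N. c k * theta N \<tau> k z) z"
    by (simp add: assms(1) theta_proj_def)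
  also have "\<dots> = (\<Sum>k=0..<int N. c k * theta_proj N j (theta N \<tau> k) z)"
    unfolding theta_proj_def sum_distrib_left times_divide_eq_right sum_divide_distrib
    by (subst sum.swap) (simp add: mult_ac)
  also have "\<dots> = (\<Sum>k=0..<int N. if k = j then c k * theta N \<tau> k z else 0)"
    by (intro sum.cong refl, subst theta_proj_theta) (use j in auto)
  also have "\<dots> = c j * theta N \<tau> j z"
    using j by simp
  finally show ?thesis using z by simp
qed

end

section \<open>Meromorphic functions and divisors on the elliptic curve\<close>

lemma mero_cases:
  obtains f where "f meromorphic_on UNIV" "F = abs_mero f"
  using Quotient_rep_reflp[OF Quotient_mero, of F] Quotient_abs_rep[OF Quotient_mero, of F]
  by (metis mero_rel_def)

lemma abs_mero_eq_iff:
  assumes "f meromorphic_on UNIV" "g meromorphic_on UNIV"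
  shows "abs_mero f = abs_mero g \<longleftrightarrow> (\<forall>z. eventually (\<lambda>w. f w = g w) (at z))"
proof -
  have "abs_mero f = abs_mero g \<longleftrightarrow> mero_rel f g"
    using Quotient_rel[OF Quotient_mero, of f g] assms by (simp add: mero_rel_refl)
  then show ?thesis
    using assms by (simp add: mero_rel_at)
qed

lemma entire_imp_meromorphic: "f holomorphic_on UNIV \<Longrightarrow> f meromorphic_on UNIV"
  by (intro analytic_on_imp_meromorphic_on) (simp add: analytic_on_open)

text \<open>Continuity removes the exceptional discrete set, so identities between classes of entire
  functions can be read pointwise.\<close>

lemma abs_mero_entire_eq_iff:
  assumes "f holomorphic_on UNIV" "g holomorphic_on UNIV"
  shows "abs_mero f = abs_mero g \<longleftrightarrow> f = g"
proof
  assume *: "abs_mero f = abs_mero g"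
  show "f = g"
  proof
    fix z
    show "f z = g z"
      using * assms continuous_eqI_at[of f g z]
      by (simp add: abs_mero_eq_iff entire_imp_meromorphic holomorphic_on_imp_continuous_on)
  qed
qed simp

lemmas abs_mero_shift = mero_shift.abs_eq[OF mero_rel_refl]
lemmas abs_mero_scale = mero_scale.abs_eq[OF mero_rel_refl]
lemmas abs_mero_reflect = mero_reflect.abs_eq[OF mero_rel_refl]
lemmas abs_mero_order = mero_order.abs_eq[OF mero_rel_refl]
lemmas abs_mero_times = times_mero.abs_eq[OF mero_rel_refl mero_rel_refl]
lemmas abs_mero_plus = plus_mero.abs_eq[OF mero_rel_refl mero_rel_refl]

lemma meromorphic_shift: "f meromorphic_on UNIV \<Longrightarrow> (\<lambda>z. f (z - u)) meromorphic_on UNIV"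
  by (rule meromorphic_on_compose[of f UNIV]) (auto intro!: analytic_intros)

lemma abs_mero_sum:
  assumes "finite A" "\<And>j. j \<in> A \<Longrightarrow> f j meromorphic_on UNIV"
  shows "abs_mero (\<lambda>z. \<Sum>j\<in>A. c j * f j z) = (\<Sum>j\<in>A. mero_scale (c j) (abs_mero (f j)))"
  using assms
proof (induction A rule: finite_induct)
  case empty
  then show ?case by (simp add: zero_mero.abs_eq)
next
  case (insert j A)
  then show ?case
    by (simp add: abs_mero_plus [symmetric] abs_mero_scale meromorphic_intros)
qed

lemma mero_nonzero_eventually:
  assumes "f meromorphic_on UNIV" "abs_mero f \<noteq> 0"
  shows "eventually (\<lambda>w. f w \<noteq> 0) (at z)"
proof -
  have "\<not> eventually (\<lambda>z. f z = 0) (cosparse UNIV)"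
    using assms by (simp add: zero_mero.abs_eq abs_mero_eq_iff meromorphic_on_const
        eventually_cosparse_open_eq)
  then have "eventually (\<lambda>z. f z \<noteq> 0) (cosparse UNIV)"
    using meromorphic_imp_constant_or_avoid[OF assms(1), of 0] by auto
  then show ?thesis
    by (simp add: eventually_cosparse_open_eq)
qed

lemma mero_order_times:
  assumes "F \<noteq> 0" "G \<noteq> 0"
  shows "mero_order (F * G) z = mero_order F z + mero_order G z"
proof -
  obtain f where f: "f meromorphic_on UNIV" "F = abs_mero f" by (rule mero_cases)
  obtain g where g: "g meromorphic_on UNIV" "G = abs_mero g" by (rule mero_cases)
  have "frequently (\<lambda>z. f z \<noteq> 0) (at z)" "frequently (\<lambda>z. g z \<noteq> 0) (at z)"
    using mero_nonzero_eventually f g assms by (auto intro!: eventually_frequently)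
  then have "zorder (\<lambda>z. f z * g z) z = zorder f z + zorder g z"
    using f(1) g(1) by (intro zorder_mult) (auto intro: meromorphic_on_subset)
  then show ?thesis
    using f g by (simp add: abs_mero_times abs_mero_order meromorphic_intros)
qed

text \<open>Serves to exclude zero divisors and to form the quotient of two functions with the same
  divisor.\<close>

lemma mero_inverse_exists:
  assumes "F \<noteq> 0"
  shows "\<exists>G. F * G = (1 :: mero)"
proof -
  obtain f where f: "f meromorphic_on UNIV" "F = abs_mero f" by (rule mero_cases)
  have "F * abs_mero (\<lambda>z. inverse (f z)) = abs_mero (\<lambda>z. f z * inverse (f z))"
    using f by (simp add: abs_mero_times meromorphic_intros)
  also have "\<dots> = 1"
    unfolding one_mero.abs_eq
  proof (subst abs_mero_eq_iff)
    show "\<forall>z. eventually (\<lambda>w. f w * inverse (f w) = 1) (at z)"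
    proof
      fix z
      have "eventually (\<lambda>w. f w \<noteq> 0) (at z)"
        using mero_nonzero_eventually[OF f(1)] assms f(2) by simp
      then show "eventually (\<lambda>w. f w * inverse (f w) = 1) (at z)"
        by eventually_elim simp
    qed
  qed (use f in \<open>auto intro!: meromorphic_intros\<close>)
  finally show ?thesis by blast
qed

text \<open>A pole would have negative order, so every singularity of a representative is removable;
  filling them in gives g.\<close>

lemma mero_entire_of_order_nonneg:
  assumes "F \<noteq> 0" "\<And>z. mero_order F z \<ge> 0"
  obtains g where "g holomorphic_on UNIV" "F = abs_mero g"
proof -
  obtain f where f: "f meromorphic_on UNIV" "F = abs_mero f" by (rule mero_cases)
  define g where "g = remove_sings f"
  have "g analytic_on {z}" for z
  proof -
    have iso: "isolated_singularity_at f z" and ne: "not_essential f z"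
      using f(1) meromorphic_on_isolated_singularity meromorphic_on_not_essential
        meromorphic_on_subset[OF f(1), of "{z}"] by auto
    have "\<not> is_pole f z"
      using isolated_pole_imp_neg_zorder[OF iso] assms(2)[of z] f by (auto simp: abs_mero_order)
    then obtain c where "f \<midarrow>z\<rightarrow> c"
      using ne by (auto simp: not_essential_def)
    then show ?thesis
      unfolding g_def using iso by (intro remove_sings_analytic_at)
  qed
  then have g: "g holomorphic_on UNIV"
    using analytic_on_analytic_at analytic_imp_holomorphic by blast
  have "eventually (\<lambda>w. f w = g w) (at z)" for z
    using eventually_remove_sings_eq[OF f(1)]
    by (auto simp: eventually_cosparse_open_eq g_def eq_commute)
  then have "F = abs_mero g"
    using f g by (simp add: abs_mero_eq_iff entire_imp_meromorphic)
  with g show ?thesis by (rule that)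
qed

lemma mero_shift_shift: "mero_shift u (mero_shift v F) = mero_shift (u + v) F"
proof -
  obtain f where f: "f meromorphic_on UNIV" "F = abs_mero f" by (rule mero_cases)
  then show ?thesis
    by (simp add: abs_mero_shift meromorphic_shift algebra_simps)
qed

lemma mero_shift_times: "mero_shift u (F * G) = mero_shift u F * mero_shift u G"
proof -
  obtain f where f: "f meromorphic_on UNIV" "F = abs_mero f" by (rule mero_cases)
  obtain g where g: "g meromorphic_on UNIV" "G = abs_mero g" by (rule mero_cases)
  from f g show ?thesis
    by (simp add: abs_mero_shift abs_mero_times meromorphic_shift meromorphic_intros)
qed

lemma mero_shift_scale: "mero_shift u (mero_scale c F) = mero_scale c (mero_shift u F)"
proof -
  obtain f where f: "f meromorphic_on UNIV" "F = abs_mero f" by (rule mero_cases)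
  then show ?thesis
    by (simp add: abs_mero_shift abs_mero_scale meromorphic_shift meromorphic_intros)
qed

lemma mero_shift_1: "mero_shift u 1 = 1"
  by (simp add: one_mero.abs_eq abs_mero_shift meromorphic_on_const)

lemma mero_scale_times: "mero_scale c F * G = mero_scale c (F * G)"
proof -
  obtain f where f: "f meromorphic_on UNIV" "F = abs_mero f" by (rule mero_cases)
  obtain g where g: "g meromorphic_on UNIV" "G = abs_mero g" by (rule mero_cases)
  from f g show ?thesis
    by (simp add: abs_mero_scale abs_mero_times meromorphic_intros mult.assoc)
qed

lemma mero_shift_lattice:
  assumes "F \<in> Ell_functions \<tau>"
  shows "mero_shift (u + of_int m + of_int n * \<tau>) F = mero_shift u F"
proof (rule invariant_under_lattice[where f = "\<lambda>u. mero_shift u F"])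
  show "mero_shift (z + 1) F = mero_shift z F" "mero_shift (z + \<tau>) F = mero_shift z F" for z
    using assms mero_shift_shift[of z _ F] by (simp_all add: Ell_functions_def flip: mero_shift_shift)
qed

text \<open>The representative chosen by \<open>rep\<close> is unknown but differs from u by a
  period of F.\<close>

lemma fun_translate_pt:
  assumes "F \<in> Ell_functions \<tau>"
  shows "fun_translate (pt \<tau> u) F = mero_shift u F"
  using rep_in_pt[of \<tau> u] mero_shift_lattice[OF assms] by (auto simp: fun_translate_def)

lemma Ell_functions_shift: "F \<in> Ell_functions \<tau> \<Longrightarrow> mero_shift u F \<in> Ell_functions \<tau>"
  by (simp add: Ell_functions_def mero_shift_shift add.commute[of _ u])
     (simp flip: mero_shift_shift)

lemma Ell_functions_entire_imp_const:
  assumes "Im \<tau> > 0" "F \<in> Ell_functions \<tau>" "g holomorphic_on UNIV" "F = abs_mero g"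
  shows "\<exists>c. F = mero_scale c 1"
proof -
  have g: "g meromorphic_on UNIV" using assms(3) by (rule entire_imp_meromorphic)
  have gs: "(\<lambda>z. g (z - u)) holomorphic_on UNIV" for u
    by (rule holomorphic_on_compose_gen[OF _ assms(3), unfolded o_def]) (auto intro!:
        holomorphic_intros)
  have per: "g (z - u) = g z" if "mero_shift u F = F" for u z
    using that gs[of u] assms(3) g
    by (simp add: assms(4) abs_mero_shift abs_mero_entire_eq_iff fun_eq_iff)
  have "g (z + u) = g z" if "mero_shift u F = F" for u z
    using per[OF that, of "z + u"] by simp
  then obtain c where "\<And>z. g z = c"
    using entire_norm_doubly_periodic_imp_const[OF assms(1,3)] assms(2)
    by (auto simp: Ell_functions_def)
  then have "g = (\<lambda>z. c * 1)" by auto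
  then have "F = mero_scale c 1"
    unfolding assms(4) one_mero.abs_eq by (simp add: abs_mero_scale meromorphic_on_const)
  then show ?thesis by blast
qed

lemma mero_times_eq_0_iff: "F * G = 0 \<longleftrightarrow> F = 0 \<or> G = (0 :: mero)"
proof
  assume *: "F * G = 0"
  show "F = 0 \<or> G = 0"
  proof (cases "F = 0")
    case False
    then obtain H where H: "F * H = 1" using mero_inverse_exists by blast
    have "G = H * (F * G)"
      using H by (simp add: mult.assoc [symmetric] mult.commute)
    with * show ?thesis by simp
  qed simp
qed auto

text \<open>F/G is elliptic and has order 0 everywhere, hence is entire and constant. This is what
  makes the description in \<open>weil\<close> pick out one value.\<close>

lemma Ell_functions_same_divisor:
  assumes "Im \<tau> > 0" and F: "F \<in> Ell_functions \<tau>" "F \<noteq> 0" and G: "G \<in> Ell_functions \<tau>" "G \<noteq> 0"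
    and div: "divisor_of \<tau> F = divisor_of \<tau> G"
  shows "\<exists>c. F = mero_scale c G"
proof -
  obtain H where H: "G * H = 1" using mero_inverse_exists[OF G(2)] by blast
  then have H0: "H \<noteq> 0" by auto
  have "mero_shift u H = H" if "mero_shift u G = G" for u
  proof -
    have "G * mero_shift u H = 1"
      using mero_shift_times[of u G H] that by (simp add: H mero_shift_1)
    then have "H = (G * mero_shift u H) * H" by simp
    also have "\<dots> = (G * H) * mero_shift u H" by (simp only: mult_ac)
    finally show ?thesis by (simp add: H)
  qed
  then have "F * H \<in> Ell_functions \<tau>"
    using F(1) G(1) by (simp add: Ell_functions_def mero_shift_times)
  moreover have "mero_order (F * H) z = 0" for z
  proof -
    have "mero_order F z = mero_order G z"
      using lookup_divisor_of[OF assms(1) F, of z] lookup_divisor_of[OF assms(1) G, of z]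
          by (simp add: div)
    moreover have "mero_order G z + mero_order H z = 0"
    proof -
      have "zorder (\<lambda>_. 1 :: complex) z = 0" by simp
      then show ?thesis
        using mero_order_times[OF G(2) H0, of z]
        by (simp add: H one_mero.abs_eq abs_mero_order meromorphic_on_const)
    qed
    ultimately show ?thesis
      using mero_order_times[OF F(2) H0, of z] by simp
  qed
  moreover have "F * H \<noteq> 0"
    using F(2) H0 by (simp add: mero_times_eq_0_iff)
  ultimately obtain c where c: "F * H = mero_scale c 1"
    using mero_entire_of_order_nonneg[of "F * H"] Ell_functions_entire_imp_const[OF assms(1)]
    by (metis order_refl)
  have "F = F * (G * H)" by (simp add: H)
  also have "\<dots> = (F * H) * G" by (simp only: mult_ac)
  finally have "F = mero_scale c G"
    by (simp add: c mero_scale_times)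
  then show ?thesis by blast
qed

text \<open>\<open>Abs_poly_mapping\<close> can be unfolded only for finite support. Here finiteness
  is recovered from the divisor itself, whose support is finite by its type and whose values on the
  curve are known.\<close>

lemma divisor_of_outside:
  assumes "Im \<tau> > 0" "f \<in> Ell_functions \<tau>" "f \<noteq> 0" "P \<notin> carrier (Ell \<tau>)"
  shows "Poly_Mapping.lookup (divisor_of \<tau> f) P = 0"
proof -
  let ?o = "\<lambda>P. if P \<in> carrier (Ell \<tau>) then mero_order f (rep P) else 0"
  have "{P. ?o P \<noteq> 0} \<subseteq> {P. Poly_Mapping.lookup (divisor_of \<tau> f) P \<noteq> 0}"
    using assms(1-3) by (auto simp: carrier_Ell lookup_divisor_of mero_order_rep)
  then have "finite {P. ?o P \<noteq> 0}"
    using finite_lookup finite_subset by blast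
  then show ?thesis
    using assms(4) by (simp add: divisor_of_def Abs_poly_mapping_inverse)
qed

text \<open>Divisors are functions on arbitrary sets of complex numbers, so agreement off the curve
  has to be secured as well.\<close>

lemma divisor_eqI:
  assumes "\<And>z. Poly_Mapping.lookup D (pt \<tau> z) = Poly_Mapping.lookup D' (pt \<tau> z)"
    "\<And>P. P \<notin> carrier (Ell \<tau>) \<Longrightarrow> Poly_Mapping.lookup D P = 0"
    "\<And>P. P \<notin> carrier (Ell \<tau>) \<Longrightarrow> Poly_Mapping.lookup D' P = 0"
  shows "D = (D' :: divisor)"
proof (rule poly_mapping_eqI)
  fix P
  show "Poly_Mapping.lookup D P = Poly_Mapping.lookup D' P"
    using assms by (cases "P \<in> carrier (Ell \<tau>)") (auto simp: carrier_Ell)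
qed

section \<open>The group law of the curve in terms of complex representatives\<close>

lemma comm_group_complex_group: "comm_group complex_group"
proof (rule comm_groupI)
  show "\<exists>y\<in>carrier complex_group. y \<otimes>\<^bsub>complex_group\<^esub> x = \<one>\<^bsub>complex_group\<^esub>" for x
    by (auto simp: complex_group_def intro!: exI[of _ "- x"])
qed (auto simp: complex_group_def)

lemma lattice_normal: "lattice \<tau> \<lhd> complex_group"
proof -
  interpret comm_group complex_group by (rule comm_group_complex_group)
  have inv: "inv\<^bsub>complex_group\<^esub> x = - x" for x
    by (rule inv_equality) (auto simp: complex_group_def)
  have "subgroup (lattice \<tau>) complex_group"
  proof (rule subgroupI)
    show "lattice \<tau> \<noteq> {}" by (auto simp: lattice_def)
    show "inv\<^bsub>complex_group\<^esub> x \<in> lattice \<tau>" if "x \<in> lattice \<tau>" for x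
    proof -
      from that obtain m n :: int where "x = of_int m + of_int n * \<tau>" by (auto simp: lattice_def)
      then have "- x = of_int (-m) + of_int (-n) * \<tau>" by simp
      then show ?thesis unfolding inv lattice_def by blast
    qed
    show "x \<otimes>\<^bsub>complex_group\<^esub> y \<in> lattice \<tau>" if "x \<in> lattice \<tau>" "y \<in> lattice \<tau>" for x y
    proof -
      from that obtain m n k l :: int where "x = of_int m + of_int n * \<tau>" "y = of_int k + of_int l * \<tau>"
        by (auto simp: lattice_def)
      then have "x \<otimes>\<^bsub>complex_group\<^esub> y = of_int (m + k) + of_int (n + l) * \<tau>"
        by (simp add: complex_group_def algebra_simps)
      then show ?thesis unfolding lattice_def by blast
    qed
  qed (auto simp: complex_group_def)
  then show ?thesis
    by (rule subgroup_imp_normal)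
qed

lemma group_Ell: "group (Ell \<tau>)"
  unfolding Ell_def by (rule normal.factorgroup_is_group[OF lattice_normal])

lemma pt_in_Ell [simp]: "pt \<tau> z \<in> carrier (Ell \<tau>)"
  by (simp add: carrier_Ell)

lemma pt_mult: "pt \<tau> a \<otimes>\<^bsub>Ell \<tau>\<^esub> pt \<tau> b = pt \<tau> (a + b)"
  using normal.rcos_sum[OF lattice_normal[of \<tau>], of a b]
  by (simp add: Ell_def FactGroup_def pt_def) (simp add: complex_group_def)

lemma pt_hom: "group_hom complex_group (Ell \<tau>) (pt \<tau>)"
  using comm_group_complex_group group_Ell
  by (auto simp: group_hom_def group_hom_axioms_def comm_group_def hom_def complex_group_def pt_mult)

lemma complex_group_nat_pow: "a [^]\<^bsub>complex_group\<^esub> (n :: nat) = of_nat n * a"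
  by (induction n) (auto simp: complex_group_def nat_pow_def algebra_simps)

lemma complex_group_int_pow: "a [^]\<^bsub>complex_group\<^esub> (n :: int) = of_int n * a"
proof -
  interpret comm_group complex_group by (rule comm_group_complex_group)
  have inv: "inv\<^bsub>complex_group\<^esub> x = - x" for x
    by (rule inv_equality) (auto simp: complex_group_def)
  show ?thesis
    by (cases n rule: int_cases3) (simp_all add: int_pow_def2 complex_group_nat_pow inv, simp add:
        complex_group_def)
qed

lemma pt_int_pow: "pt \<tau> a [^]\<^bsub>Ell \<tau>\<^esub> (n :: int) = pt \<tau> (of_int n * a)"
  using group_hom.hom_int_pow[OF pt_hom, of a \<tau> n] by (simp add: complex_group_int_pow) (simp add:
      complex_group_def)

lemma pt_nat_pow: "pt \<tau> a [^]\<^bsub>Ell \<tau>\<^esub> (n :: nat) = pt \<tau> (of_nat n * a)"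
  using pt_int_pow[of \<tau> a "int n"] by (simp only: int_pow_int of_int_of_nat_eq)

lemma pt_eq_iff: "pt \<tau> a = pt \<tau> b \<longleftrightarrow> (\<exists>m n::int. a = b + of_int m + of_int n * \<tau>)"
proof
  assume "pt \<tau> a = pt \<tau> b"
  moreover have "a \<in> pt \<tau> a" by (auto simp: mem_pt intro!: exI[of _ 0])
  ultimately show "\<exists>m n::int. a = b + of_int m + of_int n * \<tau>" by (simp add: mem_pt)
qed (auto simp: pt_add_period)

section \<open>The functions \<open>X\<^sub>k\<close>\<close>

text \<open>The common form of the divisors in the theorem: D_T for d = 0, the other one for d =
  1/(2N), and all their translates.\<close>

definition torsion_divisor :: "nat \<Rightarrow> complex \<Rightarrow> complex \<Rightarrow> divisor" where
  "torsion_divisor N \<tau> d = (\<Sum>n<N. frag_of (pt \<tau> (d + of_nat n / of_nat N)))"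

lemma div_translate_torsion_divisor:
  "div_translate \<tau> (pt \<tau> u) (torsion_divisor N \<tau> d) = torsion_divisor N \<tau> (d + u)"
  by (simp add: div_translate_def torsion_divisor_def frag_extend_sum pt_mult o_def add_ac)

lemma torsion_divisor_outside:
  "P \<notin> carrier (Ell \<tau>) \<Longrightarrow> Poly_Mapping.lookup (torsion_divisor N \<tau> d) P = 0"
  by (auto simp: torsion_divisor_def lookup_sum carrier_Ell intro!: sum.neutral)

lemma lookup_torsion_divisor:
  assumes N: "N > 0" and \<tau>: "Im \<tau> > 0"
  shows "Poly_Mapping.lookup (torsion_divisor N \<tau> d) (pt \<tau> z) =
    (if \<exists>m n::int. z = d + of_int m / of_nat N + of_int n * \<tau> then 1 else 0)"
proof -
  have sum: "Poly_Mapping.lookup (torsion_divisor N \<tau> d) (pt \<tau> z) =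
      (\<Sum>i<N. if pt \<tau> z = pt \<tau> (d + of_nat i / of_nat N) then 1 else 0)"
    by (simp add: torsion_divisor_def lookup_sum)
  show ?thesis
  proof (cases "\<exists>m n::int. z = d + of_int m / of_nat N + of_int n * \<tau>")
    case True
    then obtain m n :: int where z: "z = d + of_int m / of_nat N + of_int n * \<tau>" by blast
    \<comment> \<open>Exactly one of the N points meets the class of z, so the coefficient is 1.
      Imaginary parts give n = b, and then m is congruent to i modulo N.\<close>
    have "pt \<tau> z = pt \<tau> (d + of_nat i / of_nat N) \<longleftrightarrow> i = nat (m mod int N)" if "i < N" for i
    proof
      assume "pt \<tau> z = pt \<tau> (d + of_nat i / of_nat N)"
      then obtain a b :: int where ab: "z = d + of_nat i / of_nat N + of_int a + of_int b * \<tau>"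
        by (auto simp: pt_eq_iff)
      then have eq: "of_int m / of_nat N + of_int n * \<tau> = of_nat i / of_nat N + of_int a + of_int b * \<tau>"
        by (simp add: z)
      have "Im (of_int m / of_nat N + of_int n * \<tau>) = of_int n * Im \<tau>"
           "Im (of_nat i / of_nat N + of_int a + of_int b * \<tau>) = of_int b * Im \<tau>"
        by simp_all
      then have "of_int n * Im \<tau> = of_int b * Im \<tau>" unfolding eq by (rule trans [OF sym])
      with \<tau> have "n = b" by simp
      with eq have "of_int m = (of_int (int i + a * int N) :: complex)"
        using N by (simp add: field_simps)
      then have "m = int i + a * int N" by (simp only: of_int_eq_iff)
      with that show "i = nat (m mod int N)" by simp
    next
      assume "i = nat (m mod int N)"
      with N have "m = int i + int N * (m div int N)" by simp
      then have "of_int m = (of_int (int i + int N * (m div int N)) :: complex)" by (simp only:)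
      then have "z = d + of_nat i / of_nat N + of_int (m div int N) + of_int n * \<tau>"
        unfolding z using N by (simp add: field_simps)
      then show "pt \<tau> z = pt \<tau> (d + of_nat i / of_nat N)"
        unfolding pt_eq_iff by blast
    qed
    then have "Poly_Mapping.lookup (torsion_divisor N \<tau> d) (pt \<tau> z) = (\<Sum>i<N. if i =
        nat (m mod int N) then 1 else 0)"
      unfolding sum by (intro sum.cong) auto
    also have "\<dots> = 1"
      using N by (simp add: nat_less_iff)
    finally show ?thesis using True by simp
  next
    case False
    have "pt \<tau> z \<noteq> pt \<tau> (d + of_nat i / of_nat N)" for i
    proof
      assume "pt \<tau> z = pt \<tau> (d + of_nat i / of_nat N)"
      then obtain a b :: int where "z = d + of_nat i / of_nat N + of_int a + of_int b * \<tau>"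
        by (auto simp: pt_eq_iff)
      then have "z = d + of_int (int i + a * int N) / of_nat N + of_int b * \<tau>"
        using N by (simp add: field_simps)
      with False show False by blast
    qed
    with False show ?thesis by (simp add: sum)
  qed
qed

text \<open>Lets \<open>theta_offset N\<close> be replaced by 0 or 1/(2N) according to the parity of
  N.\<close>

lemma torsion_divisor_add:
  assumes N: "N > 0" and \<tau>: "Im \<tau> > 0"
  shows "torsion_divisor N \<tau> (d + of_int j / of_nat N) = torsion_divisor N \<tau> d"
proof (rule divisor_eqI)
  fix z
  have "(\<exists>m n::int. z = d + of_int j / of_nat N + of_int m / of_nat N + of_int n * \<tau>) \<longleftrightarrow>
        (\<exists>m n::int. z = d + of_int m / of_nat N + of_int n * \<tau>)"
  proof (intro iffI; elim exE)
    fix m n :: int assume "z = d + of_int j / of_nat N + of_int m / of_nat N + of_int n * \<tau>"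
    then have "z = d + of_int (j + m) / of_nat N + of_int n * \<tau>" by (simp add: add_divide_distrib)
    then show "\<exists>m n::int. z = d + of_int m / of_nat N + of_int n * \<tau>" by blast
  next
    fix m n :: int assume "z = d + of_int m / of_nat N + of_int n * \<tau>"
    then have "z = d + of_int j / of_nat N + of_int (m - j) / of_nat N + of_int n * \<tau>"
      by (simp add: diff_divide_distrib)
    then show "\<exists>m n::int. z = d + of_int j / of_nat N + of_int m / of_nat N + of_int n * \<tau>" by blast
  qed
  then show "Poly_Mapping.lookup (torsion_divisor N \<tau> (d + of_int j / of_nat N)) (pt \<tau> z) =
      Poly_Mapping.lookup (torsion_divisor N \<tau> d) (pt \<tau> z)"
    by (simp only: lookup_torsion_divisor[OF N \<tau>])
qed (auto intro: torsion_divisor_outside)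

context
  fixes N :: nat and \<tau> :: complex
  assumes N: "N > 0" and \<tau>: "Im \<tau> > 0"
begin

lemmas holomorphic_thetas = holomorphic_theta[OF N \<tau>]

lemma meromorphic_divide_theta: "g holomorphic_on UNIV \<Longrightarrow> (\<lambda>z. g z / theta N \<tau> l z) meromorphic_on UNIV"
  by (intro meromorphic_intros entire_imp_meromorphic holomorphic_thetas)

lemma meromorphic_theta_quotient: "theta_quotient N \<tau> k l meromorphic_on UNIV"
  unfolding theta_quotient_def by (intro meromorphic_divide_theta holomorphic_thetas)

lemma theta_eventually_nonzero: "eventually (\<lambda>w. theta N \<tau> k w \<noteq> 0) (at z)"
  using theta_nonzero[OF N \<tau>, of k] entire_eventually_nonzero[OF holomorphic_thetas] by blast

lemma abs_mero_theta_nonzero: "abs_mero (theta N \<tau> k) \<noteq> 0"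
  using theta_nonzero[OF N \<tau>, of k] holomorphic_thetas
  by (auto simp: zero_mero.abs_eq abs_mero_entire_eq_iff)

lemma abs_mero_divide_theta_times:
  assumes "g holomorphic_on UNIV"
  shows "abs_mero (\<lambda>z. g z / theta N \<tau> l z) * abs_mero (theta N \<tau> l) = abs_mero g"
proof -
  have "eventually (\<lambda>w. g w / theta N \<tau> l w * theta N \<tau> l w = g w) (at z)" for z
    using theta_eventually_nonzero[of l z] by eventually_elim simp
  moreover have g: "(\<lambda>z. g z / theta N \<tau> l z) meromorphic_on UNIV"
      and \<theta>: "theta N \<tau> l meromorphic_on UNIV"
    by (intro meromorphic_divide_theta assms entire_imp_meromorphic holomorphic_thetas)+
  moreover have m: "(\<lambda>z. g z / theta N \<tau> l z * theta N \<tau> l z) meromorphic_on UNIV"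
    by (intro meromorphic_on_mult g \<theta>)
  ultimately show ?thesis
    by (simp only: abs_mero_times[OF g \<theta>] abs_mero_eq_iff[OF m entire_imp_meromorphic[OF assms]]
        simp_thms)
qed

text \<open>A quotient is recognized by its product with theta_l, as there are no zero
  divisors.\<close>

lemma abs_mero_divide_theta_eqI:
  assumes "g holomorphic_on UNIV" "F * abs_mero (theta N \<tau> l) = abs_mero g"
  shows "F = abs_mero (\<lambda>z. g z / theta N \<tau> l z)"
proof -
  have "(F - abs_mero (\<lambda>z. g z / theta N \<tau> l z)) * abs_mero (theta N \<tau> l) = 0"
    using abs_mero_divide_theta_times[OF assms(1), of l] assms(2) by (simp add: left_diff_distrib)
  then show ?thesis
    using abs_mero_theta_nonzero[of l] by (simp add: mero_times_eq_0_iff)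
qed

lemma mero_order_theta:
  "mero_order (abs_mero (theta N \<tau> k)) z =
     Poly_Mapping.lookup (torsion_divisor N \<tau> (theta_offset N + of_int k * \<tau> / of_nat N)) (pt \<tau> z)"
  by (simp add: abs_mero_order entire_imp_meromorphic holomorphic_thetas zorder_theta[OF N \<tau>]
      theta_eq_0_iff[OF N \<tau>]
      lookup_torsion_divisor[OF N \<tau>])

lemma abs_mero_divide_theta_Ell:
  assumes g: "g \<in> theta_space N \<tau>"
  shows "abs_mero (\<lambda>z. g z / theta N \<tau> l z) \<in> Ell_functions \<tau>"
proof -
  have g_holo: "g holomorphic_on UNIV" using g by (simp add: theta_space_def)
  have "g (z - u) / theta N \<tau> l (z - u) = g z / theta N \<tau> l z" if "u = 1 \<or> u = \<tau>" for u z
  proof -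
    \<comment> \<open>The common multiplier c may depend on the point w, as it does for u =
      tau.\<close>
    have "\<exists>c. c \<noteq> 0 \<and> g (w + u) = c * g w \<and> theta N \<tau> l (w + u) = c * theta N \<tau> l w" for w
      using that g theta_in_theta_space[OF N \<tau>, of l] unfolding theta_space_def
      by (auto intro: exI[of _ "ee (of_nat N / 2)"]
          exI[of _ "ee (- of_nat N * \<tau> / 2 - of_nat N * (w + 1/2))"])
    from this[of "z - u"] show ?thesis by auto
  qed
  then show ?thesis
    by (simp add: Ell_functions_def abs_mero_shift meromorphic_divide_theta[OF g_holo])
qed

lemma theta_space_lincomb: "(\<lambda>z. \<Sum>j\<in>A. c j * theta N \<tau> j z) \<in> theta_space N \<tau>"
  using theta_in_theta_space[OF N \<tau>]
  by (auto simp: theta_space_def sum_distrib_left mult.left_commute intro!: holomorphic_intros)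

lemma Xfun_eq: "Xfun N \<tau> k = abs_mero (\<lambda>z. theta N \<tau> k z / theta N \<tau> 0 z)"
  by (simp add: Xfun_def theta_quotient_def)

lemma Xfun_times_theta: "Xfun N \<tau> k * abs_mero (theta N \<tau> 0) = abs_mero (theta N \<tau> k)"
  unfolding Xfun_eq by (rule abs_mero_divide_theta_times[OF holomorphic_thetas])

lemma Xfun_Ell: "Xfun N \<tau> k \<in> Ell_functions \<tau>"
  unfolding Xfun_eq by (rule abs_mero_divide_theta_Ell[OF theta_in_theta_space[OF N \<tau>]])

lemma Xfun_nonzero: "Xfun N \<tau> k \<noteq> 0"
  using Xfun_times_theta[of k] abs_mero_theta_nonzero[of k] by auto

lemma mero_order_Xfun:
  "mero_order (Xfun N \<tau> k) z =
     Poly_Mapping.lookup (torsion_divisor N \<tau> (theta_offset N + of_int k * \<tau> / of_nat N)) (pt \<tau> z)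
     - Poly_Mapping.lookup (torsion_divisor N \<tau> (theta_offset N)) (pt \<tau> z)"
  using mero_order_times[OF Xfun_nonzero abs_mero_theta_nonzero, of k 0 z]
  by (simp add: Xfun_times_theta mero_order_theta)

lemma divisor_of_Xfun:
  "divisor_of \<tau> (Xfun N \<tau> k) = torsion_divisor N \<tau> (theta_offset N + of_int k * \<tau> / of_nat N)
     - torsion_divisor N \<tau> (theta_offset N)"
  by (rule divisor_eqI[of _ \<tau>])
     (simp_all add: lookup_divisor_of[OF \<tau> Xfun_Ell Xfun_nonzero] mero_order_Xfun lookup_minus
        divisor_of_outside[OF \<tau> Xfun_Ell Xfun_nonzero] torsion_divisor_outside)

text \<open>The factors of theta_k and theta_0 under T are -zeta_N^k and -1; the signs
  cancel.\<close>

lemma Xfun_shift_T: "mero_shift (1 / of_nat N) (Xfun N \<tau> k) = mero_scale (zeta N powi k) (Xfun N \<tau> k)"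
proof -
  have "theta N \<tau> k (z - 1 / of_nat N) / theta N \<tau> 0 (z - 1 / of_nat N) =
      zeta N powi k * (theta N \<tau> k z / theta N \<tau> 0 z)" for z
    using theta_diff_T[OF N \<tau>, of _ z 1]
    by (simp add: ee_add zeta_def ee_powi)
  then show ?thesis
    by (simp add: Xfun_eq abs_mero_shift abs_mero_scale meromorphic_divide_theta holomorphic_thetas)
qed

lemma Xfun_shift_S:
  "mero_shift (\<tau> / of_nat N) (Xfun N \<tau> k) = Xfun N \<tau> (k + 1) * abs_mero (theta_quotient N \<tau> 0 1)"
proof -
  have *: "theta N \<tau> k (z - \<tau> / of_nat N) / theta N \<tau> 0 (z - \<tau> / of_nat N) =
      theta N \<tau> (k + 1) z / theta N \<tau> 1 z" for z
    by (simp add: theta_diff_S[OF N \<tau>])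
  have "mero_shift (\<tau> / of_nat N) (Xfun N \<tau> k) = abs_mero (\<lambda>z. theta N \<tau> (k + 1) z / theta N \<tau> 1 z)"
    by (simp add: Xfun_eq abs_mero_shift meromorphic_divide_theta holomorphic_thetas *)
  also have "\<dots> = Xfun N \<tau> (k + 1) * abs_mero (theta_quotient N \<tau> 0 1)"
  proof (rule abs_mero_divide_theta_eqI[OF holomorphic_thetas, symmetric])
    show "Xfun N \<tau> (k + 1) * abs_mero (theta_quotient N \<tau> 0 1) * abs_mero (theta N \<tau> 1) =
        abs_mero (theta N \<tau> (k + 1))"
      unfolding mult.assoc theta_quotient_def abs_mero_divide_theta_times[OF holomorphic_thetas]
          by (rule Xfun_times_theta)
  qed
  finally show ?thesis .
qed

lemma Xfun_reflect: "mero_reflect (Xfun N \<tau> k) = Xfun N \<tau> (- k)"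
  by (simp add: Xfun_eq abs_mero_reflect meromorphic_divide_theta holomorphic_thetas theta_minus[OF
      N \<tau>])

section \<open>The Weil pairing of S and T\<close>

lemma weil_S_T: "weil \<tau> N (pt \<tau> (\<tau> / of_nat N)) (pt \<tau> (1 / of_nat N)) = zeta N"
proof -
  have div: "(\<Sum>n<N. frag_of (pt \<tau> (\<tau> / of_nat N) \<otimes>\<^bsub>Ell \<tau>\<^esub> pt \<tau> (1 / of_nat N) [^]\<^bsub>Ell \<tau>\<^esub> n)
         - frag_of (pt \<tau> (1 / of_nat N) [^]\<^bsub>Ell \<tau>\<^esub> n)) =
       torsion_divisor N \<tau> (\<tau> / of_nat N) - torsion_divisor N \<tau> 0" (is "?D = _")
    by (simp add: torsion_divisor_def pt_nat_pow pt_mult sum_subtractf)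
  \<comment> \<open>X_1 has the prescribed divisor up to translation by
    \<open>theta_offset N\<close>. Undoing this commutes with translation by T, so f inherits the
    eigenvalue zeta_N.\<close>
  define f where "f = mero_shift (- theta_offset N) (Xfun N \<tau> 1)"
  have f: "f \<in> Ell_functions \<tau>"
    unfolding f_def by (intro Ell_functions_shift Xfun_Ell)
  have f0: "f \<noteq> 0"
  proof
    assume "f = 0"
    moreover have "mero_shift u 0 = 0" for u
      by (simp add: zero_mero.abs_eq abs_mero_shift meromorphic_on_const)
    ultimately have "mero_shift (theta_offset N) f = 0" by simp
    then have "mero_shift 0 (Xfun N \<tau> 1) = 0"
      by (simp add: f_def mero_shift_shift)
    then show False
      using Xfun_nonzero[of 1] by (simp add: Xfun_eq abs_mero_shift meromorphic_divide_theta
          holomorphic_thetas)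
  qed
  have fdiv: "divisor_of \<tau> f = ?D"
    unfolding div
  proof (rule divisor_eqI[of _ \<tau>])
    have "(\<exists>m n::int. z + theta_offset N = theta_offset N + d + of_int m / of_nat N + of_int n * \<tau>) \<longleftrightarrow>
          (\<exists>m n::int. z = d + of_int m / of_nat N + of_int n * \<tau>)" for z d
      by (simp add: algebra_simps)
    then have *: "Poly_Mapping.lookup (torsion_divisor N \<tau> (theta_offset N + d)) (pt \<tau> (z +
        theta_offset N)) =
        Poly_Mapping.lookup (torsion_divisor N \<tau> d) (pt \<tau> z)" for z d
      by (simp only: lookup_torsion_divisor[OF N \<tau>])
    have "mero_order f z = mero_order (Xfun N \<tau> 1) (z + theta_offset N)" for z
      by (simp add: f_def mero_order_shift)
    then show "Poly_Mapping.lookup (divisor_of \<tau> f) (pt \<tau> z) =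
        Poly_Mapping.lookup (torsion_divisor N \<tau> (\<tau> / of_nat N) - torsion_divisor N \<tau> 0) (pt \<tau> z)" for z
      using *[of 0] *[of "\<tau> / of_nat N"]
      by (simp add: lookup_divisor_of[OF \<tau> f f0] mero_order_Xfun lookup_minus)
  qed (simp_all add: divisor_of_outside[OF \<tau> f f0] torsion_divisor_outside lookup_minus)
  have translate: "fun_translate (pt \<tau> (1 / of_nat N)) f = mero_scale (zeta N) f"
  proof -
    have "mero_shift (1 / of_nat N) f = mero_shift (- theta_offset N) (mero_shift (1 / of_nat N)
        (Xfun N \<tau> 1))"
      by (simp only: f_def mero_shift_shift add.commute)
    then show ?thesis
      unfolding fun_translate_pt[OF f] by (simp add: Xfun_shift_T mero_shift_scale f_def)
  qed
  show ?thesis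
    unfolding weil_def
  proof (rule the_equality)
    \<comment> \<open>Any other admissible function is a multiple of f, hence has the same
      eigenvalue.\<close>
    fix c assume "\<exists>g\<in>Ell_functions \<tau>. g \<noteq> 0 \<and> divisor_of \<tau> g = ?D \<and>
        fun_translate (pt \<tau> (1 / of_nat N)) g = mero_scale c g"
    then obtain g where g: "g \<in> Ell_functions \<tau>" "g \<noteq> 0" "divisor_of \<tau> g = ?D"
      "fun_translate (pt \<tau> (1 / of_nat N)) g = mero_scale c g" by blast
    then obtain d where d: "g = mero_scale d f"
      using Ell_functions_same_divisor[OF \<tau> g(1,2) f f0] fdiv by auto
    have "mero_scale c g = mero_shift (1 / of_nat N) (mero_scale d f)"
      using g(4) fun_translate_pt[OF g(1)] d by simp
    also have "\<dots> = mero_scale d (mero_scale (zeta N) f)"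
      using translate fun_translate_pt[OF f] by (simp add: mero_shift_scale)
    also have "\<dots> = mero_scale (zeta N) g"
      by (simp add: d mult.commute)
    finally show "c = zeta N" using g(2) by simp
  qed (use f f0 fdiv translate in blast)
qed

section \<open>The space L^1 and its basis\<close>

lemma L1_torsion_divisor:
  "L1 \<tau> (torsion_divisor N \<tau> (theta_offset N)) = (\<lambda>g. abs_mero (\<lambda>z. g z / theta N \<tau> 0 z)) `
      theta_space N \<tau>"
    (is "?L = ?R")
proof (intro equalityI subsetI)
  fix h assume h: "h \<in> ?L"
  have hE: "h \<in> Ell_functions \<tau>" using h by (simp add: L1_def)
  \<comment> \<open>The case h = 0 is separate because orders and divisors carry information only
    for nonzero functions.\<close>
  obtain g where g: "g holomorphic_on UNIV" "h * abs_mero (theta N \<tau> 0) = abs_mero g"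
  proof (cases "h = 0")
    case True
    then show ?thesis by (intro that[of "\<lambda>_. 0"]) (auto simp flip: zero_mero.abs_eq)
  next
    case False
    then have eff: "effective (divisor_of \<tau> h + torsion_divisor N \<tau> (theta_offset N))"
      using h by (simp add: L1_def)
    have "mero_order (h * abs_mero (theta N \<tau> 0)) z \<ge> 0" for z
    proof -
      have "0 \<le> Poly_Mapping.lookup (divisor_of \<tau> h + torsion_divisor N \<tau> (theta_offset N)) (pt \<tau> z)"
        using eff by (simp only: effective_def)
      then show ?thesis
        by (simp add: lookup_add lookup_divisor_of[OF \<tau> hE False] mero_order_theta
            mero_order_times[OF False abs_mero_theta_nonzero])
    qed
    then show ?thesis
      using mero_entire_of_order_nonneg[of "h * abs_mero (theta N \<tau> 0)"] False
          abs_mero_theta_nonzero that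
      by (metis mero_times_eq_0_iff)
  qed
  \<comment> \<open>Since h is invariant under u, g = h theta_0 takes over the multiplier of
    theta_0. Translation is by -u because \<open>mero_shift\<close> subtracts.\<close>
  have transfer: "g (z - u) = E z * g z"
    if u: "mero_shift u h = h" and E: "E holomorphic_on UNIV" and \<theta>: "\<And>z. theta N \<tau> 0 (z - u) =
        E z * theta N \<tau> 0 z"
    for u E z
  proof -
    have "abs_mero (\<lambda>z. g (z - u)) = mero_shift u (h * abs_mero (theta N \<tau> 0))"
      using g by (simp add: abs_mero_shift entire_imp_meromorphic)
    also have "\<dots> = h * abs_mero (\<lambda>z. E z * theta N \<tau> 0 z)"
      by (simp add: mero_shift_times u abs_mero_shift entire_imp_meromorphic holomorphic_thetas \<theta>)
    also have "abs_mero (\<lambda>z. E z * theta N \<tau> 0 z) = abs_mero E * abs_mero (theta N \<tau> 0)"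
      by (simp add: abs_mero_times entire_imp_meromorphic holomorphic_thetas E)
    also have "h * \<dots> = abs_mero E * abs_mero g"
      by (simp add: g(2) [symmetric] mult_ac)
    also have "\<dots> = abs_mero (\<lambda>z. E z * g z)"
      by (simp add: abs_mero_times entire_imp_meromorphic E g(1))
    finally have "(\<lambda>z. g (z - u)) = (\<lambda>z. E z * g z)"
      by (subst (asm) abs_mero_entire_eq_iff)
         (auto intro!: holomorphic_intros E g(1) holomorphic_on_compose_gen[OF _ g(1), unfolded o_def])
    then show ?thesis by (rule fun_cong)
  qed
  have h1: "mero_shift 1 h = h" and h\<tau>: "mero_shift \<tau> h = h"
    using hE by (simp_all add: Ell_functions_def)
  define \<mu> where "\<mu> z = - of_nat N * \<tau> / 2 - of_nat N * (z + 1/2)" for z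
  have \<theta>: "theta N \<tau> 0 (z + 1) = ee (of_nat N / 2) * theta N \<tau> 0 z"
    "theta N \<tau> 0 (z + \<tau>) = ee (\<mu> z) * theta N \<tau> 0 z" for z
    using theta_in_theta_space[OF N \<tau>, of 0] by (auto simp: theta_space_def \<mu>_def)
  have \<theta>1: "theta N \<tau> 0 (z - 1) = ee (- (of_nat N / 2)) * theta N \<tau> 0 z" for z
    using \<theta>(1)[of "z - 1"] by (simp add: ee_minus)
  have \<theta>\<tau>: "theta N \<tau> 0 (z - \<tau>) = ee (- \<mu> (z - \<tau>)) * theta N \<tau> 0 z" for z
    using \<theta>(2)[of "z - \<tau>"] by (simp add: ee_minus)
  have E: "(\<lambda>z. ee (- \<mu> (z - \<tau>))) holomorphic_on UNIV"
    unfolding \<mu>_def by (intro holomorphic_intros) auto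
  have "g (z + 1) = ee (of_nat N / 2) * g z" for z
    using transfer[OF h1 holomorphic_on_const \<theta>1, of "z + 1"] by (simp add: ee_minus)
  moreover have "g (z + \<tau>) = ee (\<mu> z) * g z" for z
    using transfer[OF h\<tau> E \<theta>\<tau>, of "z + \<tau>"] by (simp add: ee_minus)
  ultimately have "g \<in> theta_space N \<tau>"
    using g(1) by (simp add: theta_space_def \<mu>_def)
  moreover have "h = abs_mero (\<lambda>z. g z / theta N \<tau> 0 z)"
    by (rule abs_mero_divide_theta_eqI[OF g])
  ultimately show "h \<in> ?R" by blast
next
  fix h assume "h \<in> ?R"
  then obtain g where g: "g \<in> theta_space N \<tau>" and h: "h = abs_mero (\<lambda>z. g z / theta N \<tau> 0 z)" by blast
  have g_holo: "g holomorphic_on UNIV" using g by (simp add: theta_space_def)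
  have hE: "h \<in> Ell_functions \<tau>" unfolding h by (rule abs_mero_divide_theta_Ell[OF g])
  have "effective (divisor_of \<tau> h + torsion_divisor N \<tau> (theta_offset N))" if h0: "h \<noteq> 0"
    unfolding effective_def
  proof
    fix P
    show "0 \<le> Poly_Mapping.lookup (divisor_of \<tau> h + torsion_divisor N \<tau> (theta_offset N)) P"
    proof (cases "P \<in> carrier (Ell \<tau>)")
      case True
      then obtain z where P: "P = pt \<tau> z" by (auto simp: carrier_Ell)
      have hg: "h * abs_mero (theta N \<tau> 0) = abs_mero g"
        unfolding h by (rule abs_mero_divide_theta_times[OF g_holo])
      then have "abs_mero g \<noteq> 0"
        using h0 abs_mero_theta_nonzero by (metis mero_times_eq_0_iff)
      then have "mero_order (abs_mero g) z \<ge> 0"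
        using mero_nonzero_eventually[of g z] holomorphic_on_imp_analytic_at[OF g_holo open_UNIV]
        by (auto simp: abs_mero_order entire_imp_meromorphic g_holo
            intro!: zorder_ge_0 eventually_frequently)
      then show ?thesis
        using mero_order_times[OF h0 abs_mero_theta_nonzero, of 0 z]
        by (simp add: P hg mero_order_theta lookup_add lookup_divisor_of[OF \<tau> hE h0])
    next
      case False
      then show ?thesis
        by (simp add: lookup_add divisor_of_outside[OF \<tau> hE h0] torsion_divisor_outside)
    qed
  qed
  with hE show "h \<in> ?L" by (auto simp: L1_def)
qed

lemma sum_scale_Xfun:
  "finite A \<Longrightarrow> (\<Sum>k\<in>A. mero_scale (c k) (Xfun N \<tau> k)) =
      abs_mero (\<lambda>z. (\<Sum>k\<in>A. c k * theta N \<tau> k z) / theta N \<tau> 0 z)"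
  using abs_mero_sum[of A "\<lambda>k z. theta N \<tau> k z / theta N \<tau> 0 z" c]
  by (simp add: Xfun_eq meromorphic_divide_theta holomorphic_thetas sum_divide_distrib)

lemma Xfun_lin_indep:
  assumes "(\<Sum>k=0..<int N. mero_scale (c k) (Xfun N \<tau> k)) = 0" "j \<in> {0..<int N}"
  shows "c j = 0"
proof (rule theta_lin_indep[OF N \<tau> _ assms(2)])
  have holo: "(\<lambda>z. \<Sum>k=0..<int N. c k * theta N \<tau> k z) holomorphic_on UNIV"
    by (intro holomorphic_intros holomorphic_thetas)
  have "abs_mero (\<lambda>z. \<Sum>k=0..<int N. c k * theta N \<tau> k z) = abs_mero (\<lambda>_. 0)"
    using abs_mero_divide_theta_times[OF holo, of 0] assms(1)
    by (simp add: sum_scale_Xfun zero_mero.abs_eq [symmetric])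
  then show "(\<Sum>k=0..<int N. c k * theta N \<tau> k z) = 0" for z
    by (subst (asm) abs_mero_entire_eq_iff) (use holo in \<open>auto simp: fun_eq_iff\<close>)
qed

lemma Xfun_basis: "is_basis (Xfun N \<tau>) {0..<int N} (L1 \<tau> (torsion_divisor N \<tau> (theta_offset N)))"
  unfolding is_basis_def
proof (intro conjI)
  show inj: "inj_on (Xfun N \<tau>) {0..<int N}"
  proof (rule inj_onI, rule ccontr)
    fix j k assume jk: "j \<in> {0..<int N}" "k \<in> {0..<int N}" "Xfun N \<tau> j = Xfun N \<tau> k" "j \<noteq> k"
    \<comment> \<open>The relation X_j - X_k = 0, padded with zero coefficients. Injectivity comes
      first because it converts sums over the set of functions into sums over indices.\<close>
    have "(\<Sum>i=0..<int N. mero_scale (if i = j then 1 else if i = k then -1 else 0) (Xfun N \<tau> i)) =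
      (\<Sum>i\<in>{j, k}. mero_scale (if i = j then 1 else if i = k then -1 else 0) (Xfun N \<tau> i))"
      using jk by (intro sum.mono_neutral_right) auto
    also have "\<dots> = 0"
      using jk by simp
    finally show False
      using Xfun_lin_indep[of "\<lambda>i. if i = j then 1 else if i = k then -1 else 0" j] jk by simp
  qed
  show "mero.independent (Xfun N \<tau> ` {0..<int N})"
  proof (rule mero.independent_if_scalars_zero)
    fix f x assume sum: "(\<Sum>x\<in>Xfun N \<tau> ` {0..<int N}. mero_scale (f x) x) = 0"
      and x: "x \<in> Xfun N \<tau> ` {0..<int N}"
    show "f x = 0"
      using Xfun_lin_indep[of "\<lambda>k. f (Xfun N \<tau> k)"] sum x by (auto simp: sum.reindex[OF inj])
  qed auto
  show "mero.span (Xfun N \<tau> ` {0..<int N}) = L1 \<tau> (torsion_divisor N \<tau> (theta_offset N))"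
  proof (intro equalityI subsetI)
    fix h assume "h \<in> mero.span (Xfun N \<tau> ` {0..<int N})"
    then obtain u where "h = (\<Sum>k=0..<int N. mero_scale (u (Xfun N \<tau> k)) (Xfun N \<tau> k))"
      by (auto simp: mero.span_finite sum.reindex[OF inj])
    then show "h \<in> L1 \<tau> (torsion_divisor N \<tau> (theta_offset N))"
      using theta_space_lincomb unfolding L1_torsion_divisor by (auto simp: sum_scale_Xfun)
  next
    fix h assume "h \<in> L1 \<tau> (torsion_divisor N \<tau> (theta_offset N))"
    then obtain g where g: "g \<in> theta_space N \<tau>" "h = abs_mero (\<lambda>z. g z / theta N \<tau> 0 z)"
      unfolding L1_torsion_divisor by blast
    obtain c where "\<And>z. g z = (\<Sum>j=0..<int N. c j * theta N \<tau> j z)"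
      using theta_space_expand[OF N \<tau> g(1)] by blast
    then have "h = (\<Sum>k=0..<int N. mero_scale (c k) (Xfun N \<tau> k))"
      by (simp add: g(2) sum_scale_Xfun)
    then show "h \<in> mero.span (Xfun N \<tau> ` {0..<int N})"
      by (simp only:) (intro mero.span_sum mero.span_scale mero.span_base imageI)
  qed
qed

end

theorem theorem5p9:
  fixes N :: nat and \<tau> :: complex and S T T' :: "complex set"
    and X :: "int \<Rightarrow> mero" and D\<^sub>T D\<^sub>T' :: divisor
  assumes "N > 0" and "Im \<tau> > 0"
    and "S = pt \<tau> (\<tau> / of_nat N)"
    and "T = pt \<tau> (1 / of_nat N)"
    and "T' = pt \<tau> (1 / (2 * of_nat N))"
    and "X = Xfun N \<tau>"
    and "D\<^sub>T = (\<Sum>n<N. frag_of (T [^]\<^bsub>Ell \<tau>\<^esub> n))"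
    and "D\<^sub>T' = (\<Sum>n<N. frag_of (T' \<otimes>\<^bsub>Ell \<tau>\<^esub> T [^]\<^bsub>Ell \<tau>\<^esub> n))"
  shows "(\<forall>k. theta_quotient N \<tau> k 0 meromorphic_on UNIV \<and> X k \<in> Ell_functions \<tau>)
    \<and> (\<forall>k. fun_translate T (X k) = mero_scale (weil_char \<tau> N T S T powi k) (X k) \<and>
          mero_scale (weil_char \<tau> N T S T powi k) (X k) = mero_scale (zeta N powi k) (X k))
    \<and> (\<forall>k. fun_translate S (X k) = X (k + 1) * abs_mero (theta_quotient N \<tau> 0 1))
    \<and> (\<forall>k. mero_reflect (X k) = X (- k))
    \<and> (odd N \<longrightarrow>
          (\<forall>k. divisor_of \<tau> (X k) = div_translate \<tau> (S [^]\<^bsub>Ell \<tau>\<^esub> k) D\<^sub>T - D\<^sub>T) \<and>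
          is_basis X {0..<int N} (L1 \<tau> D\<^sub>T))
    \<and> (even N \<longrightarrow>
          (\<forall>k. divisor_of \<tau> (X k) = div_translate \<tau> (S [^]\<^bsub>Ell \<tau>\<^esub> k) D\<^sub>T' - D\<^sub>T') \<and>
          is_basis X {0..<int N} (L1 \<tau> D\<^sub>T'))"
proof -
  note N = assms(1) and \<tau> = assms(2)
  have weil: "weil_char \<tau> N T S T = zeta N"
    by (simp add: weil_char_def generate.incl weil_S_T[OF N \<tau>] assms(3,4))
  have DT: "D\<^sub>T = torsion_divisor N \<tau> 0"
    by (simp add: assms(4,7) torsion_divisor_def pt_nat_pow)
  have DT': "D\<^sub>T' = torsion_divisor N \<tau> (1 / (2 * of_nat N))"
    by (simp add: assms(4,5,8) torsion_divisor_def pt_nat_pow pt_mult)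
  \<comment> \<open>For N = 2 j + 1 the offset (1 - N)/(2N) equals -j/N.\<close>
  have odd: "D\<^sub>T = torsion_divisor N \<tau> (theta_offset N)" if "odd N"
  proof -
    from that obtain j where j: "N = 2 * j + 1" by (rule oddE)
    then have "1 - of_nat N = 2 * (of_int (- int j) :: complex)" by simp
    then have "theta_offset N = 0 + of_int (- int j) / of_nat N"
      by (simp only: theta_offset_def) simp
    then show ?thesis
      unfolding DT by (simp only: torsion_divisor_add[OF N \<tau>])
  qed
  \<comment> \<open>For N = 2 j the offset equals 1/(2N) - j/N.\<close>
  have even: "D\<^sub>T' = torsion_divisor N \<tau> (theta_offset N)" if "even N"
  proof -
    from that obtain j where j: "N = 2 * j" by (rule evenE)
    have "theta_offset N = 1 / (2 * of_nat N) + of_int (- int j) / of_nat N"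
      using N by (simp add: theta_offset_def j field_simps)
    then show ?thesis
      unfolding DT' by (simp only: torsion_divisor_add[OF N \<tau>])
  qed
  have div: "divisor_of \<tau> (X k) = div_translate \<tau> (S [^]\<^bsub>Ell \<tau>\<^esub> k) D - D"
    if "D = torsion_divisor N \<tau> (theta_offset N)" for D k
    by (simp add: that assms(3,6) divisor_of_Xfun[OF N \<tau>] pt_int_pow div_translate_torsion_divisor)
  show ?thesis
    using Xfun_basis[OF N \<tau>] div odd even weil
    by (auto simp: assms(3,4,6) meromorphic_theta_quotient[OF N \<tau>] Xfun_Ell[OF N \<tau>]
        fun_translate_pt[OF Xfun_Ell[OF N \<tau>]]
        Xfun_shift_T[OF N \<tau>] Xfun_shift_S[OF N \<tau>] Xfun_reflect[OF N \<tau>])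
qed

end
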